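(* As power series (Laurent series where negative powers appear) in $q$, $|q|<1$: (1) \begin{align*} \sum_{n\ge0}N^{0}(0,8;2n+1)q^n=&-q^{21}g(-q^{32};q^{64})+q^5\frac{J_{32}^8J_{128}^2}{J_{16}^4J_{64}^5}+\frac{1}{4}\frac{J_{2}^8J_{8}^2}{J_{1}^4J_{4}^5}+\frac{1}{4}\frac{J_{4}^3}{J_{2}^2}+\frac{1}{2}\frac{J_{2}^5J_{16}}{J_{1}^2J_{4}^2J_{8}}-\frac{1}{2}q\frac{J_{8}^8J_{32}^2}{J_{4}^4J_{16}^5}-\frac{1}{2}q\frac{J_{16}^3}{J_{8}^2},\\ \sum_{n\ge0}N^{0}(0,8;4n+1)q^n=&\frac{1}{4}\left(\frac{J_{2}^9}{J_{1}^6J_{4}^2} +\frac{J_{2}^3}{J_{1}^2}+2\frac{J_{4}^4}{J_{8}J_{2}^2}\right),\\ \sum_{n\ge0}N^{0}(0,8;4n+3)q^n=&-q^{10}g(-q^{16};q^{32})+q^2\frac{J_{16}^8J_{64}^2}{J_{8}^4J_{32}^5}+\frac{1}{2}\frac{J_{8}^3}{J_{4}^2}+\frac{J_{4}^6}{J_{1}^2J_{2}^3}-\frac{1}{2}\frac{J_{4}^8J_{16}^2}{J_{2}^4J_{8}^5},\\ \sum_{n\ge0}N^{0}(0,8;8n+1)q^n=&\frac{1}{2}\frac{J_{2}^4}{J_{1}^2J_4}+\frac{1}{4}\frac{J_{4}^5}{J_{1}^2J_{8}^2}+\frac{1}{4}\frac{J_{2}^{12}J_{4}}{J_{1}^{10}J_{8}^2}+2q\frac{J_{2}^2J_{4}^3J_{8}^2}{J_{1}^6},\\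 \sum_{n\ge0}N^{0}(0,8;8n+3)q^n=&-q^5g(-q^8;q^{16})+q\frac{J_{8}^8J_{32}^2}{J_{4}^4J_{16}^5}+\frac{1}{2}\frac{J_{4}^3}{J_{2}^2}-\frac{1}{2}\frac{J_{2}^8J_{8}^2}{J_{1}^4J_{4}^5}+\frac{J_{2}^6J_{4}^5}{J_{1}^8J_{8}^2},\\ \sum_{n\ge0}N^{0}(0,8;8n+5)q^n=&2\frac{J_{4}^9}{J_{1}^6J_{8}^2},\qquad \sum_{n\ge0}N^{0}(0,8;8n+7)q^n=2\frac{J_{2}^8J_{8}^2}{J_{1}^8J_{4}}. \end{align*} (2) \begin{align*} \sum_{n\ge0}N^{0}(1,8;2n)q^n=&-\frac{1}{4}+\frac{1}{4}g(-1;q^4)+\frac{1}{2}q^4g(q^4;q^{16})+\frac{1}{8}\frac{J_{2}^6J_{4}}{J_{1}^4J_{8}^2}-\frac{1}{4}\frac{J_{8}^7}{J_{4}^3J_{16}^3}+\frac{1}{4}\frac{J_{2}^5J_{8}^2}{J_{1}^2J_{4}^3J_{16}},\\ \sum_{n\ge0}N^{0}(1,8;4n)q^n=&-\frac{1}{4}+\frac{1}{4}g(-1;q^2)+\frac{1}{2}q^2g(q^2;q^8)+\frac{1}{8}\frac{J_{2}^{15}}{J_{1}^8J_{4}^6},\qquad \sum_{n\ge0}N^{0}(1,8;4n+2)q^n=\frac{1}{2}\left(\frac{J_{2}^3J_{4}^2}{J_{1}^4}+\frac{J_4J_8}{J_2} \right),\\ \sum_{n\ge0}N^{0}(1,8;8n)q^n=&-\frac{1}{4}+\frac{1}{4}g(-1;q)+\frac{1}{2}qg(q;q^4)+\frac{1}{8}\frac{J_{2}^{22}}{J_{1}^{13}J_{4}^8}+2q\frac{J_{4}^8}{J_{1}^5J_{2}^2},\\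 \sum_{n\ge0}N^{0}(1,8;8n+2)q^n=&\frac{1}{2}\left(\frac{J_{2}^{16}}{J_{1}^{11}J_{4}^4}+\frac{J_2J_4}{J_1} \right),\qquad \sum_{n\ge0}N^{0}(1,8;8n+4)q^n=\frac{J_{2}^{10}}{J_{1}^9},\qquad \sum_{n\ge0}N^{0}(1,8;8n+6)q^n=2\frac{J_{2}^4J_{4}^4}{J_{1}^7}. \end{align*} (3) \begin{align*} \sum_{n\ge0}N^{0}(2,8;2n+1)q^n=&-\frac{1}{2}q^{-1}+\frac{1}{2}q^{-1}g(-1;q^{16})+\frac{1}{4}q^{-1}\frac{J_{8}^{6}J_{16}}{J_{4}^4J_{32}^2}+\frac{1}{4}\frac{J_{2}^8J_{8}^2}{J_{4}^5J_{1}^4}-\frac{1}{4}\frac{J_{4}^3}{J_{2}^2},\\ \sum_{n\ge0}N^{0}(2,8;4n+1)q^n=&q\frac{J_{2}^4J_{16}^2}{J_{1}^4J_{8}},\qquad \sum_{n\ge0}N^{0}(2,8;4n+3)q^n=-\frac{1}{2}q^{-1}+\frac{1}{2}q^{-1}g(-1;q^8)+\frac{1}{4}q^{-1}\frac{J_{4}^6J_{8}}{J_{2}^4J_{16}^2}+\frac{J_{4}^6}{J_{1}^2J_{2}^3},\\ \sum_{n\ge0}N^{0}(2,8;8n+1)q^n=&4q\frac{J_{2}^2J_{4}^3J_{8}^2}{J_{1}^6},\qquad \sum_{n\ge0}N^{0}(2,8;8n+3)q^n=\frac{J_{2}^6J_{4}^5}{J_{1}^8J_{8}^2},\qquad \sum_{n\ge0}N^{0}(2,8;8n+5)q^n=\frac{J_{2}^{14}J_{8}^2}{J_{1}^{10}J_{4}^5},\\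 \sum_{n\ge0}N^{0}(2,8;8n+7)q^n=&-\frac{1}{2}q^{-1}+\frac{1}{2}q^{-1}g(-1;q^4)+\frac{1}{4}q^{-1}\frac{J_{2}^6J_{4}}{J_{1}^4J_{8}^2}+2\frac{J_{2}^8J_{8}^2}{J_{1}^8J_{4}}. \end{align*} (4) \begin{align*} \sum_{n\ge0}N^{0}(3,8;2n)q^n=&-\frac{1}{4}+\frac{1}{4}g(-1;q^4)-\frac{1}{2}q^4g(q^4;q^{16})+\frac{1}{4}\frac{J_{8}^7}{J_{4}^3J_{16}^3}-\frac{1}{4}\frac{J_{2}^5J_{8}^2}{J_{1}^2J_{4}^3J_{16}}+\frac{1}{8}\frac{J_{2}^6J_{4}}{J_{1}^4J_{8}^2},\\ \sum_{n\ge0}N^{0}(3,8;4n)q^n=&-\frac{1}{4}+\frac{1}{4}g(-1;q^2)-\frac{1}{2}q^2g(q^2;q^8)+\frac{1}{4}\frac{J_{4}^7}{J_{2}^3J_{8}^3}-\frac{1}{4}\frac{J_{4}^7}{J_{2}^3J_{8}^3}+\frac{1}{8}\frac{J_{2}^{15}}{J_{4}^6J_{1}^8},\\ \sum_{n\ge0}N^{0}(3,8;4n+2)q^n=&\frac{1}{2}\left(\frac{J_{2}^3J_{4}^2}{J_{1}^4}-\frac{J_4J_8}{J_2} \right),\qquad \sum_{n\ge0}N^{0}(3,8;8n)q^n=-\frac{1}{4}+\frac{1}{4}g(-1;q)-\frac{1}{2}qg(q;q^4)+\frac{1}{8}\frac{J_{2}^{22}}{J_{1}^{13}J_{4}^8}+2q\frac{J_{4}^8}{J_{1}^5J_{2}^2},\\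 \sum_{n\ge0}N^{0}(3,8;8n+2)q^n=&\frac{1}{2}\left(\frac{J_{2}^{16}}{J_{1}^{11}J_{4}^4}-\frac{J_2J_4}{J_1} \right),\qquad \sum_{n\ge0}N^{0}(3,8;8n+4)q^n=\frac{J_{2}^{10}}{J_{1}^9},\qquad \sum_{n\ge0}N^{0}(3,8;8n+6)q^n=2\frac{J_{2}^4J_{4}^4}{J_{1}^7}. \end{align*} (5) \begin{align*} \sum_{n\ge0}N^{0}(4,8;2n+1)q^n=&q^{-3}-q^{-3}g(-1;q^{64})-\frac{1}{2}q^{-3}\frac{J_{32}^6J_{64}}{J_{16}^4J_{128}^2}+\frac{1}{4}\left(\frac{J_{2}^8J_{8}^2}{J_{1}^4J_{4}^5}-2\frac{J_{2}^5J_{16}}{J_{1}^2J_{4}^2J_{8}}+\frac{J_{4}^3}{J_{2}^2} \right)+\frac{1}{2}q\left( \frac{J_{16}^3}{J_{8}^2}-\frac{J_{8}^8J_{32}^2}{J_{4}^4J_{16}^5}\right),\\ \sum_{n\ge0}N^{0}(4,8;4n+1)q^n=&\frac{1}{4}\left(\frac{J_{2}^9}{J_{1}^6J_{4}^2}-2\frac{J_{4}^4}{J_{2}^2J_{8}}+\frac{J_{2}^3}{J_{1}^2} \right),\\ \sum_{n\ge0}N^{0}(4,8;4n+3)q^n=&q^{-2}-q^{-2}g(-1;q^{32})-\frac{1}{2}q^{-2}\frac{J_{16}^6J_{32}}{J_{8}^4J_{64}^2}-\frac{1}{2}\frac{J_{8}^3}{J_{4}^2}-\frac{1}{2}\frac{J_{4}^8J_{16}^2}{J_{2}^4J_{8}^5}+\frac{J_{4}^6}{J_{2}^3J_{1}^2},\\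 \sum_{n\ge0}N^{0}(4,8;8n+1)q^n=&\frac{1}{4}\frac{J_{2}^{12}J_{4}}{J_{1}^{10}J_{8}^2}+2q\frac{J_{2}^2J_{4}^3J_{8}^2}{J_{1}^6}-\frac{1}{2}\frac{J_{2}^4}{J_{1}^2J_{4}}+\frac{1}{4}\frac{J_{4}^5}{J_{1}^2J_{8}^2},\\ \sum_{n\ge0}N^{0}(4,8;8n+3)q^n=&q^{-1}-q^{-1}g(-1;q^{16})-\frac{1}{2}q^{-1}\frac{J_{8}^6J_{16}}{J_{4}^4J_{32}^2}-\frac{1}{2}\frac{J_{4}^3}{J_{2}^2}-\frac{1}{2}\frac{J_{2}^8J_{8}^2}{J_{1}^4J_{4}^5}+\frac{J_{2}^6J_{4}^5}{J_{1}^8J_{8}^2},\\ \sum_{n\ge0}N^{0}(4,8;8n+5)q^n=&2\frac{J_{4}^9}{J_{1}^6J_{8}^2},\qquad \sum_{n\ge0}N^{0}(4,8;8n+7)q^n=2\frac{J_{2}^8J_{8}^2}{J_{1}^8J_{4}}. \end{align*}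
   Context: For $|q|<1$: $(a;q)_n=\prod_{k=0}^{n-1}(1-aq^k)$, $(a;q)_\infty=\prod_{k\ge0}(1-aq^k)$, $J_m=(q^m;q^m)_\infty$, and for $x$ not an integer power of $q$, \[g(x;q)=x^{-1}\Big(-1+\sum_{n=0}^{\infty}\frac{q^{n^2}}{(x;q)_{n+1}(q/x;q)_{n}}\Big)\] (expressions such as $g(-q^{32};q^{64})$ mean this function with $x=-q^{32}$ and $q$ replaced by $q^{64}$). An odd Durfee symbol of a positive integer $n$ consists of a nonnegative integer $D$ together with two (possibly empty) non-increasing sequences of odd positive integers $a_1\ge\cdots\ge a_s$ (top row) and $b_1\ge\cdots\ge b_t$ (bottom row), all entries at most $2D+1$, with $n=\sum a_i+\sum b_j+2D^2+2D+1$; its odd rank is $s-t$. $N^{0}(a,M;n)$ is the number of odd Durfee symbols of $n$ with odd rank congruent to $a$ modulo $M$, and $N^0(a,M;0)=0$. *)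

theory Defs
  imports "HOL-Analysis.Analysis" "HOL-Number_Theory.Cong"
begin

definition qpoch :: "complex \<Rightarrow> complex \<Rightarrow> nat \<Rightarrow> complex" where
  "qpoch a q n = (\<Prod>k<n. 1 - a * q ^ k)"

definition qpoch_inf :: "complex \<Rightarrow> complex \<Rightarrow> complex" where
  "qpoch_inf a q = (\<Prod>k. 1 - a * q ^ k)"

definition qJ :: "nat \<Rightarrow> complex \<Rightarrow> complex" where
  "qJ m q = qpoch_inf (q ^ m) (q ^ m)"

text \<open>The universal mock theta function \<open>g(x; q)\<close>, meaningful for \<open>0 < \<bar>q\<bar> < 1\<close> and
  \<open>x\<close> not an integer power of \<open>q\<close>.\<close>

definition mock_g :: "complex \<Rightarrow> complex \<Rightarrow> complex" where
  "mock_g x q = inverse x * (-1 + (\<Sum>n. q ^ (n\<^sup>2) / (qpoch x q (n + 1) * qpoch (q / x) q n)))"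

text \<open>A symbol is a triple of the number \<open>D\<close>, the top row and the bottom row. There is none for
  \<open>n = 0\<close>, so \<open>N0 a M 0 = 0\<close> needs no separate convention (see \<open>N0_0\<close> below).\<close>

definition odd_Durfee_symbols :: "nat \<Rightarrow> (nat \<times> nat list \<times> nat list) set" where
  "odd_Durfee_symbols n =
     {(D, as, bs). sorted_wrt (\<ge>) as \<and> sorted_wrt (\<ge>) bs \<and>
        (\<forall>x\<in>set as \<union> set bs. odd x \<and> x \<le> 2 * D + 1) \<and>
        n = sum_list as + sum_list bs + 2 * D\<^sup>2 + 2 * D + 1}"

definition odd_rank :: "nat \<times> nat list \<times> nat list \<Rightarrow> int" where
  "odd_rank = (\<lambda>(D, as, bs). int (length as) - int (length bs))"

definition N0 :: "int \<Rightarrow> int \<Rightarrow> nat \<Rightarrow> nat" where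
  "N0 a M n = card {S \<in> odd_Durfee_symbols n. [odd_rank S = a] (mod M)}"

lemma N0_0: "N0 a M 0 = 0"
  by (simp add: N0_def odd_Durfee_symbols_def)

lemma finite_odd_Durfee_symbols: "finite (odd_Durfee_symbols n)"
proof -
  have len: "length xs \<le> sum_list xs" if "\<forall>x\<in>set xs. odd x" for xs :: "nat list"
    using that by (induction xs) (auto elim!: oddE)
  have "odd_Durfee_symbols n \<subseteq>
      {..n} \<times> {xs. set xs \<subseteq> {..n} \<and> length xs \<le> n} \<times> {xs. set xs \<subseteq> {..n} \<and> length xs \<le> n}"
  proof
    fix S assume "S \<in> odd_Durfee_symbols n"
    then obtain D as bs where S: "S = (D, as, bs)"
      and odd: "\<forall>x\<in>set as. odd x" "\<forall>x\<in>set bs. odd x"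
      and n: "n = sum_list as + sum_list bs + 2 * D\<^sup>2 + 2 * D + 1"
      by (auto simp: odd_Durfee_symbols_def)
    have "x \<le> n" if "x \<in> set as \<or> x \<in> set bs" for x
      using that member_le_sum_list[of x as] member_le_sum_list[of x bs] n by auto
    moreover have "length as \<le> n" "length bs \<le> n" "D \<le> n"
      using len[OF odd(1)] len[OF odd(2)] n by auto
    ultimately show "S \<in> {..n} \<times> {xs. set xs \<subseteq> {..n} \<and> length xs \<le> n} \<times>
        {xs. set xs \<subseteq> {..n} \<and> length xs \<le> n}"
      by (auto simp: S)
  qed
  then show ?thesis
    by (rule finite_subset) (intro finite_cartesian_product finite_lists_length_le finite_atMost)
qed

end

theory Submission
  imports Defs "HOL-Complex_Analysis.Conformal_Mappings"
begin

text \<open>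
  With \<open>R(x; q) = q g(x q; q\<^sup>2)\<close> the two-variable generating function of the odd rank, the counts
  modulo 8 are combinations of \<open>R\<close> at eighth roots of unity. All these values are reduced to one
  another by a single identity,
  \<open>g(x; q) + g(-x; q) + 2 q g(-q x\<^sup>2; q\<^sup>4) = C(q) / ((x\<^sup>2, q\<^sup>2/x\<^sup>2; q\<^sup>2) (-q x\<^sup>2, -q\<^sup>3/x\<^sup>2; q\<^sup>4))\<close>:
  multiplied by the denominator on the right, the left-hand side is holomorphic for \<open>x \<noteq> 0\<close> and
  invariant under \<open>x \<mapsto> q\<^sup>2 x\<close>, hence constant by the maximum principle. Comparing its values at
  \<open>x = 1\<close> and \<open>x\<^sup>2 = -1/q\<close> shows that \<open>C(q) J\<^sub>1\<^sup>2 J\<^sub>4 / J\<^sub>2\<^sup>4\<close> is invariant under \<open>q \<mapsto> q\<^sup>4\<close>,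
  hence equal to its limit \<open>2\<close> at \<open>q = 0\<close>. This yields the formulas for the progressions modulo 2.
  The finer ones follow by splitting into even and odd powers of \<open>q\<close>, which only needs the
  2-dissections of \<open>\<phi>(q)\<close> and \<open>\<phi>(q)\<^sup>2\<close> for \<open>\<phi>(q) = J\<^sub>2\<^sup>5 / (J\<^sub>1\<^sup>2 J\<^sub>4\<^sup>2)\<close>.
\<close>

section \<open>Infinite q-Pochhammer symbols\<close>

lemma norm_power_less_one:
  fixes q :: complex
  assumes "norm q < 1" "n > 0"
  shows "norm (q ^ n) < 1"
  using power_strict_mono[of "norm q" 1 n] assms by (simp add: norm_power)

lemma convergent_prod_qpoch:
  fixes a q :: complex
  assumes "norm q < 1"
  shows "convergent_prod (\<lambda>k. 1 - a * q ^ k)"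
proof -
  have "summable (\<lambda>k. norm a * norm q ^ k)"
    using assms by (intro summable_mult summable_geometric) auto
  then have "summable (\<lambda>k. norm ((1 - a * q ^ k) - 1))"
    by (simp add: norm_mult norm_power)
  then show ?thesis
    by (intro abs_convergent_prod_imp_convergent_prod summable_imp_abs_convergent_prod)
qed

lemma qpoch_LIMSEQ:
  assumes "norm q < 1"
  shows "qpoch a q \<longlonglongrightarrow> qpoch_inf a q"
proof -
  have "(\<lambda>n. \<Prod>k\<le>n. 1 - a * q ^ k) \<longlonglongrightarrow> qpoch_inf a q"
    using convergent_prod_LIMSEQ[OF convergent_prod_qpoch[OF assms]] by (simp add: qpoch_inf_def)
  then have "(\<lambda>n. qpoch a q (Suc n)) \<longlonglongrightarrow> qpoch_inf a q"
    by (simp only: qpoch_def lessThan_Suc_atMost)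
  then show ?thesis
    by (simp add: filterlim_sequentially_Suc)
qed

lemma qpoch_0 [simp]: "qpoch a q 0 = 1"
  by (simp add: qpoch_def)

lemma qpoch_Suc: "qpoch a q (Suc n) = qpoch a q n * (1 - a * q ^ n)"
  by (simp add: qpoch_def)

lemma qpoch_add: "qpoch a q (m + n) = qpoch a q m * qpoch (a * q ^ m) q n"
  by (induction n) (simp_all add: qpoch_Suc power_add mult_ac)

lemma qpoch_inf_0_left [simp]: "qpoch_inf 0 q = 1"
  by (simp add: qpoch_inf_def)

lemma qpoch_inf_split:
  assumes "norm q < 1"
  shows "qpoch_inf a q = qpoch a q m * qpoch_inf (a * q ^ m) q"
proof (rule LIMSEQ_unique)
  show "(\<lambda>n. qpoch a q (n + m)) \<longlonglongrightarrow> qpoch_inf a q"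
    using qpoch_LIMSEQ[OF assms] by (rule LIMSEQ_ignore_initial_segment)
  have "(\<lambda>n. qpoch a q m * qpoch (a * q ^ m) q n) \<longlonglongrightarrow> qpoch a q m * qpoch_inf (a * q ^ m) q"
    by (intro tendsto_intros qpoch_LIMSEQ assms)
  then show "(\<lambda>n. qpoch a q (n + m)) \<longlonglongrightarrow> qpoch a q m * qpoch_inf (a * q ^ m) q"
    by (simp add: qpoch_add add.commute[of _ m])
qed

lemma qpoch_inf_step:
  assumes "norm q < 1"
  shows "qpoch_inf a q = (1 - a) * qpoch_inf (a * q) q"
  using qpoch_inf_split[OF assms, of a 1] by (simp add: qpoch_def)

lemma qpoch_inf_nonzero:
  assumes "norm q < 1" "norm a < 1"
  shows "qpoch_inf a q \<noteq> 0"
proof -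
  have "a * q ^ k \<noteq> 1" for k
  proof -
    have "norm (a * q ^ k) \<le> norm a"
      using assms by (simp add: norm_mult norm_power mult_left_le power_le_one)
    with assms(2) show ?thesis
      by (metis norm_one not_less)
  qed
  then show ?thesis
    unfolding qpoch_inf_def
    using assms by (intro prodinf_nonzero convergent_prod_qpoch) auto
qed

lemma qpoch_inf_square:
  assumes "norm q < 1"
  shows "qpoch_inf a q = qpoch_inf a (q\<^sup>2) * qpoch_inf (a * q) (q\<^sup>2)"
proof -
  have q2: "norm (q\<^sup>2) < 1"
    using assms by (simp add: norm_power_less_one)
  have eq: "qpoch a q (2 * n) = qpoch a (q\<^sup>2) n * qpoch (a * q) (q\<^sup>2) n" for n
  proof (induction n)
    case (Suc n)
    have "qpoch a q (2 * Suc n) = qpoch a q (2 * n) * (1 - a * (q\<^sup>2) ^ n) * (1 - a * q * (q\<^sup>2) ^ n)"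
      by (simp add: qpoch_Suc power_mult power2_eq_square power_mult_distrib mult_ac)
    then show ?case
      by (simp add: qpoch_Suc Suc)
  qed simp
  have "(\<lambda>n. qpoch a q (2 * n)) \<longlonglongrightarrow> qpoch_inf a q"
    using LIMSEQ_subseq_LIMSEQ[OF qpoch_LIMSEQ[OF assms, of a], of "\<lambda>n. 2 * n"]
    by (simp add: o_def strict_mono_def)
  moreover have "(\<lambda>n. qpoch a (q\<^sup>2) n * qpoch (a * q) (q\<^sup>2) n)
      \<longlonglongrightarrow> qpoch_inf a (q\<^sup>2) * qpoch_inf (a * q) (q\<^sup>2)"
    by (intro tendsto_mult qpoch_LIMSEQ q2)
  ultimately show ?thesis
    unfolding eq by (rule LIMSEQ_unique)
qed

lemma qpoch_inf_mult_minus: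
  assumes "norm q < 1"
  shows "qpoch_inf a q * qpoch_inf (- a) q = qpoch_inf (a\<^sup>2) (q\<^sup>2)"
proof -
  have q2: "norm (q\<^sup>2) < 1"
    using assms by (simp add: norm_power_less_one)
  have "qpoch a q n * qpoch (- a) q n = qpoch (a\<^sup>2) (q\<^sup>2) n" for n
    unfolding qpoch_def prod.distrib[symmetric]
    by (intro prod.cong) (simp_all add: power2_eq_square power_mult_distrib algebra_simps)
  moreover have "(\<lambda>n. qpoch a q n * qpoch (- a) q n) \<longlonglongrightarrow> qpoch_inf a q * qpoch_inf (- a) q"
    by (intro tendsto_mult qpoch_LIMSEQ assms)
  ultimately show ?thesis
    using LIMSEQ_unique[OF _ qpoch_LIMSEQ[OF q2, of "a\<^sup>2"]] by simp
qed

lemma norm_qpoch_inf_le: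
  assumes "norm q < 1"
  shows "norm (qpoch_inf a q) \<le> exp (norm a / (1 - norm q))"
proof (rule LIMSEQ_le_const2[OF tendsto_norm[OF qpoch_LIMSEQ[OF assms]]], intro exI allI impI)
  fix n
  have "norm (qpoch a q n) \<le> (\<Prod>k<n. 1 + norm a * norm q ^ k)"
    unfolding qpoch_def prod_norm[symmetric]
  proof (intro prod_mono conjI norm_ge_zero)
    fix k
    show "norm (1 - a * q ^ k) \<le> 1 + norm a * norm q ^ k"
      using norm_triangle_ineq4[of 1 "a * q ^ k"] by (simp add: norm_mult norm_power)
  qed
  also have "\<dots> \<le> exp (\<Sum>k<n. norm a * norm q ^ k)"
    by (intro prod_le_exp_sum) auto
  also have "(\<Sum>k<n. norm a * norm q ^ k) \<le> (\<Sum>k. norm a * norm q ^ k)"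
    using assms by (intro sum_le_suminf summable_mult summable_geometric) auto
  also have "(\<Sum>k. norm a * norm q ^ k) = norm a / (1 - norm q)"
    using assms by (subst suminf_mult) (auto simp: suminf_geometric summable_geometric)
  finally show "norm (qpoch a q n) \<le> exp (norm a / (1 - norm q))"
    by simp
qed

lemma cball_norm_bounds:
  fixes q :: "complex \<Rightarrow> complex" and f :: "complex \<Rightarrow> 'a :: real_normed_vector"
  assumes "open A" "z \<in> A" "continuous_on A f" "continuous_on A q"
    and "\<And>w. w \<in> A \<Longrightarrow> norm (q w) < 1"
  obtains d r B where "d > 0" "cball z d \<subseteq> A" "r < 1"
    "\<forall>w\<in>cball z d. norm (f w) \<le> B" "\<forall>w\<in>cball z d. norm (q w) \<le> r"
proof -
  obtain d where d: "d > 0" "cball z d \<subseteq> A"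
    using assms(1,2) open_contains_cball by blast
  have "compact (f ` cball z d)"
    using d by (intro compact_continuous_image continuous_on_subset[OF assms(3)]) auto
  then obtain B where B: "\<forall>w\<in>cball z d. norm (f w) \<le> B"
    using compact_imp_bounded by (fastforce simp: bounded_iff)
  have "\<exists>w\<in>cball z d. \<forall>v\<in>cball z d. norm (q v) \<le> norm (q w)"
    using d(1) continuous_on_subset[OF assms(4) d(2)]
    by (intro continuous_attains_sup continuous_on_norm) auto
  then obtain w where "w \<in> cball z d" "\<forall>v\<in>cball z d. norm (q v) \<le> norm (q w)"
    by blast
  with d B assms(5) show ?thesis
    by (intro that[of d "norm (q w)" B]) auto
qed

lemma uniform_limit_qpoch:
  fixes a q :: "complex \<Rightarrow> complex"
  assumes cont: "continuous_on K a" "continuous_on K q" and "compact K" "0 \<le> r" "r < 1"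
    and a: "\<forall>z\<in>K. norm (a z) \<le> B" and q: "\<forall>z\<in>K. norm (q z) \<le> r"
  shows "uniform_limit K (\<lambda>n z. qpoch (a z) (q z) n) (\<lambda>z. qpoch_inf (a z) (q z)) sequentially"
proof -
  have "uniformly_convergent_on K (\<lambda>N z. \<Prod>n<N. 1 + - a z * q z ^ n)"
  proof (rule uniformly_convergent_on_prod)
    show "uniformly_convergent_on K (\<lambda>N z. \<Sum>n<N. norm (- a z * q z ^ n))"
    proof (rule Weierstrass_m_test')
      show "summable (\<lambda>n. B * r ^ n)"
        using \<open>0 \<le> r\<close> \<open>r < 1\<close> by (intro summable_mult summable_geometric) auto
      show "norm (norm (- a z * q z ^ n)) \<le> B * r ^ n" if "z \<in> K" for n z
      proof -
        have "norm (a z) \<le> B" "norm (q z) \<le> r"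
          using a q that by auto
        moreover from this have "B \<ge> 0"
          using norm_ge_zero order_trans by blast
        ultimately show ?thesis
          by (auto simp: norm_mult norm_power intro!: mult_mono power_mono)
      qed
    qed
  qed (use cont \<open>compact K\<close> in \<open>auto intro!: continuous_intros\<close>)
  then have "uniform_limit K (\<lambda>n z. qpoch (a z) (q z) n)
      (\<lambda>z. lim (\<lambda>n. qpoch (a z) (q z) n)) sequentially"
    by (simp add: qpoch_def uniformly_convergent_uniform_limit_iff)
  also have "?this \<longleftrightarrow> ?thesis"
    using q \<open>r < 1\<close> by (intro uniform_limit_cong') (auto intro!: limI qpoch_LIMSEQ)
  finally show ?thesis .
qed

lemma holomorphic_qpoch_inf [holomorphic_intros]:
  assumes a: "a holomorphic_on A" and q: "q holomorphic_on A" and "open A"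
    and q_less: "\<And>z. z \<in> A \<Longrightarrow> norm (q z) < 1"
  shows "(\<lambda>z. qpoch_inf (a z) (q z)) holomorphic_on A"
proof (rule holomorphic_uniform_sequence[OF \<open>open A\<close>])
  show "(\<lambda>z. qpoch (a z) (q z) n) holomorphic_on A" for n
    unfolding qpoch_def by (intro holomorphic_intros a q)
  have cont: "continuous_on A a" "continuous_on A q"
    using a q by (auto intro: holomorphic_on_imp_continuous_on)
  fix z assume "z \<in> A"
  then obtain d r B where d: "d > 0" "cball z d \<subseteq> A" and "r < 1"
    and B: "\<forall>w\<in>cball z d. norm (a w) \<le> B" and r: "\<forall>w\<in>cball z d. norm (q w) \<le> r"
    by (rule cball_norm_bounds[OF \<open>open A\<close> _ cont q_less])
  have "r \<ge> 0"
    using d(1) r order_trans[OF norm_ge_zero, of "q z"] by simp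
  have "uniform_limit (cball z d) (\<lambda>n w. qpoch (a w) (q w) n)
      (\<lambda>w. qpoch_inf (a w) (q w)) sequentially"
    using cont[THEN continuous_on_subset, OF d(2)] \<open>r \<ge> 0\<close> \<open>r < 1\<close> B r
    by (intro uniform_limit_qpoch) auto
  with d show "\<exists>d>0. cball z d \<subseteq> A \<and>
      uniform_limit (cball z d) (\<lambda>n w. qpoch (a w) (q w) n)
        (\<lambda>w. qpoch_inf (a w) (q w)) sequentially"
    by blast
qed

lemma qJ_nonzero:
  assumes "norm q < 1" "m > 0"
  shows "qJ m q \<noteq> 0"
  unfolding qJ_def using assms by (intro qpoch_inf_nonzero norm_power_less_one)

lemma qJ_0 [simp]: "m > 0 \<Longrightarrow> qJ m 0 = 1"
  by (simp add: qJ_def zero_power)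

lemma holomorphic_qJ [holomorphic_intros]:
  assumes "m > 0"
  shows "qJ m holomorphic_on ball 0 1"
  unfolding qJ_def[abs_def] using assms by (intro holomorphic_intros norm_power_less_one) auto

lemma qJ_power: "qJ m (q ^ k) = qJ (k * m) q"
  by (simp add: qJ_def power_mult)

lemma qJ_power_simps:
  "qJ (numeral m) (q ^ k) = qJ (k * numeral m) q"
  "qJ 1 (q ^ k) = qJ k q" "qJ (Suc 0) (q ^ k) = qJ k q"
  by (simp_all add: qJ_power)

lemma qpoch_inf_minus_self:
  assumes "norm q < 1"
  shows "qpoch_inf (- q) q = qJ 2 q / qJ 1 q"
  using qpoch_inf_mult_minus[OF assms, of q] qJ_nonzero[OF assms, of 1]
  by (simp add: qJ_def field_simps)

lemma qpoch_inf_odd: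
  assumes "norm q < 1"
  shows "qpoch_inf q (q\<^sup>2) = qJ 1 q / qJ 2 q"
  using qpoch_inf_square[OF assms, of q] qJ_nonzero[OF assms, of 2]
  by (simp add: qJ_def field_simps power2_eq_square)

lemma qpoch_inf_minus_odd:
  assumes "norm q < 1"
  shows "qpoch_inf (- q) (q\<^sup>2) = (qJ 2 q)\<^sup>2 / (qJ 1 q * qJ 4 q)"
proof -
  have q2: "norm (q\<^sup>2) < 1"
    using assms by (simp add: norm_power_less_one)
  have "qpoch_inf q (q\<^sup>2) * qpoch_inf (- q) (q\<^sup>2) = qJ 2 q / qJ 4 q"
    using qpoch_inf_mult_minus[OF q2, of q] qpoch_inf_odd[OF q2] by (simp add: qJ_power)
  then show ?thesis
    unfolding qpoch_inf_odd[OF assms] using qJ_nonzero[OF assms]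
    by (simp add: field_simps power2_eq_square)
qed

section \<open>Functional equations under dilation\<close>

lemma multiplicative_shift_induct:
  fixes p x :: complex
  assumes p: "p \<noteq> 0" "norm p < 1" and "x \<noteq> 0"
    and shift: "\<And>y. y \<noteq> 0 \<Longrightarrow> P (p * y) \<longleftrightarrow> P y"
    and annulus: "\<And>y. norm p < norm y \<Longrightarrow> norm y \<le> 1 \<Longrightarrow> P y"
  shows "P x"
proof -
  have shift_nat: "P (p ^ n * y) \<longleftrightarrow> P y" if "y \<noteq> 0" for n y
    by (induction n) (use that p shift in \<open>simp_all add: mult.assoc\<close>)
  have shift_int: "P (p powi k * x) \<longleftrightarrow> P x" for k
  proof (cases k rule: int_cases2)
    case (nonpos n)
    then show ?thesis
      using shift_nat[of "p powi k * x" n] p \<open>x \<noteq> 0\<close>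
      by (simp add: power_int_minus mult.assoc[symmetric])
  qed (use shift_nat[OF \<open>x \<noteq> 0\<close>] in simp)
  define t where "t = ln (norm x) / ln (norm p)"
  have "norm (p powi - \<lfloor>t\<rfloor> * x) = norm p powr frac t"
  proof -
    have "norm (p powi - \<lfloor>t\<rfloor> * x) = norm p powr (- of_int \<lfloor>t\<rfloor>) * norm p powr t"
      using p \<open>x \<noteq> 0\<close> by (simp add: norm_mult norm_power_int powr_def t_def flip: powr_real_of_int')
    then show ?thesis
      by (simp add: frac_def flip: powr_add)
  qed
  moreover have "norm p powr 1 < norm p powr frac t" "norm p powr frac t \<le> norm p powr 0"
    using p frac_lt_1[of t] frac_ge_0[of t] powr_less_mono'[of "norm p" "frac t" 1]
      powr_mono'[of 0 "frac t" "norm p"] by auto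
  ultimately have "P (p powi - \<lfloor>t\<rfloor> * x)"
    using p by (intro annulus) auto
  then show ?thesis
    using shift_int by blast
qed

lemma multiplicatively_periodic_value_in_closed_annulus:
  fixes f :: "complex \<Rightarrow> 'a" and p x :: complex
  assumes s: "0 < s" "s < 1" "norm p = s * s"
    and periodic: "\<And>x. 1 < norm x \<Longrightarrow> norm x < 1 / norm p \<Longrightarrow> f (p * x) = f x"
    and x: "norm p < norm x" "norm x < 1 / norm p"
  shows "\<exists>y. s \<le> norm y \<and> norm y \<le> 1 / s \<and> f y = f x"
proof -
  have s_less: "1 < 1 / s" "1 / s < 1 / norm p"
    using s by (simp_all add: field_simps)
  consider "norm x < s" | "s \<le> norm x" "norm x \<le> 1 / s" | "1 / s < norm x"
    by linarith
  then show ?thesis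
  proof cases
    case 1
    have "p \<noteq> 0"
      using s by auto
    have "1 < norm (x / p)" "norm (x / p) < 1 / s"
      using 1 x(1) s by (auto simp: norm_divide field_simps)
    with s_less s(2) periodic[of "x / p"] \<open>p \<noteq> 0\<close> show ?thesis
      by (intro exI[of _ "x / p"]) auto
  next
    case 3
    with x s have "s < norm (p * x)" "norm (p * x) < 1"
      by (auto simp: norm_mult field_simps)
    with s_less 3 x periodic[of x] show ?thesis
      by (intro exI[of _ "p * x"]) auto
  qed auto
qed

lemma multiplicatively_periodic_constant_annulus:
  fixes f :: "complex \<Rightarrow> complex"
  assumes p: "p \<noteq> 0" "norm p < 1"
  defines "A \<equiv> {x. norm p < norm x \<and> norm x < 1 / norm p}"
  assumes hol: "f holomorphic_on A"
    and periodic: "\<And>x. 1 < norm x \<Longrightarrow> norm x < 1 / norm p \<Longrightarrow> f (p * x) = f x"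
  shows "f constant_on A"
proof -
  define s where "s = sqrt (norm p)"
  have s: "0 < s" "s < 1" "norm p = s * s"
    using p by (simp_all add: s_def)
  define K :: "complex set" where "K = {x. s \<le> norm x \<and> norm x \<le> 1 / s}"
  have "norm p < s" "1 / s < 1 / norm p"
    using s by (simp_all add: divide_strict_left_mono)
  then have "K \<subseteq> A"
    by (auto simp: K_def A_def)
  have "K = cball 0 (1 / s) - ball 0 s"
    by (auto simp: K_def)
  then have "compact K"
    by (auto intro: compact_diff)
  moreover have "1 \<in> K"
    using s by (simp add: K_def)
  ultimately obtain w where w: "w \<in> K" "\<And>y. y \<in> K \<Longrightarrow> norm (f y) \<le> norm (f w)"
    using continuous_attains_sup[of K "\<lambda>x. norm (f x)"]
      continuous_on_subset[OF holomorphic_on_imp_continuous_on[OF hol] \<open>K \<subseteq> A\<close>]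
    by (auto intro: continuous_on_norm)
  have "open A"
    unfolding A_def by (intro open_Collect_conj open_Collect_less continuous_intros)
  show ?thesis
  proof (rule maximum_modulus_principle[OF hol \<open>open A\<close> _ \<open>open A\<close> order_refl])
    show "connected A"
      using connected_annulus(1)[of "norm p" "0 :: complex" "1 / norm p"] by (simp add: A_def)
    show "norm (f x) \<le> norm (f w)" if x: "x \<in> A" for x
    proof -
      obtain y where "y \<in> K" "f y = f x"
        using multiplicatively_periodic_value_in_closed_annulus
          [where f = f and x = x, OF s periodic] x
        by (auto simp: A_def K_def)
      with w(2) show ?thesis
        by metis
    qed
  qed (use w(1) \<open>K \<subseteq> A\<close> in blast)
qed

lemma multiplicatively_periodic_constant:
  assumes p: "p \<noteq> 0" "norm p < 1" and hol: "f holomorphic_on - {0}"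
    and periodic: "\<And>x. x \<noteq> 0 \<Longrightarrow> f (p * x) = f x" and x: "x \<noteq> 0"
  shows "f x = f 1"
  using p x
proof (rule multiplicative_shift_induct[where P = "\<lambda>x. f x = f 1"])
  define A :: "complex set" where "A = {x. norm p < norm x \<and> norm x < 1 / norm p}"
  have "1 < 1 / norm p"
    using p by simp
  have "f constant_on A"
    unfolding A_def
    by (rule multiplicatively_periodic_constant_annulus
         [OF p holomorphic_on_subset[OF hol] periodic])
       auto
  then show "f y = f 1" if "norm p < norm y" "norm y \<le> 1" for y
    using that p(2) \<open>1 < 1 / norm p\<close> by (auto simp: constant_on_def A_def)
qed (simp_all add: periodic)

lemma power_times_iterated_power_tendsto_0:
  fixes c q :: complex
  assumes "k \<ge> 2" "norm c \<le> real k" "norm q < 1"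
  shows "(\<lambda>n. c ^ n * q ^ (k ^ n)) \<longlonglongrightarrow> 0"
proof (rule Lim_null_comparison)
  have sub: "filterlim (\<lambda>n. k ^ n) sequentially sequentially"
    using assms(1) by (intro filterlim_subseq) (auto simp: strict_mono_def)
  show "(\<lambda>n. of_nat (k ^ n) * norm q ^ (k ^ n)) \<longlonglongrightarrow> 0"
    by (rule filterlim_compose[OF powser_times_n_limit_0 sub]) (use assms(3) in simp)
  have "norm (c ^ n * q ^ (k ^ n)) \<le> of_nat (k ^ n) * norm q ^ (k ^ n)" for n
    using power_mono[OF assms(2), of n] by (auto simp: norm_mult norm_power intro!: mult_right_mono)
  then show "\<forall>\<^sub>F n in sequentially. norm (c ^ n * q ^ (k ^ n)) \<le> of_nat (k ^ n) * norm q ^ (k ^ n)"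
    by (intro always_eventually allI)
qed

lemma functional_equation_imp_zero:
  fixes f :: "complex \<Rightarrow> complex"
  assumes deriv: "(f has_field_derivative D) (at 0)" and "f 0 = 0"
    and eq: "\<And>q. q \<noteq> 0 \<Longrightarrow> norm q < 1 \<Longrightarrow> f q = c * f (q ^ k)"
    and k: "k \<ge> 2" "norm c \<le> real k"
    and q: "norm q < 1" "q \<noteq> 0"
  shows "f q = 0"
proof -
  define p where "p n = q ^ (k ^ n)" for n
  have p: "p n \<noteq> 0" "norm (p n) < 1" for n
    using q k by (simp_all add: p_def norm_power power_Suc_less_one power_less_one_iff)
  have iterate: "f q = c ^ n * f (p n)" for n
  proof (induction n)
    case (Suc n)
    have "f (p n) = c * f (p (Suc n))"
      using eq[OF p] by (simp add: p_def mult.commute[of k] power_mult)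
    then show ?case
      by (simp add: Suc.IH)
  qed (simp add: p_def)
  have "filterlim p (at 0) sequentially"
    using p power_times_iterated_power_tendsto_0[OF k(1), of 1 q] k(1) q(1)
    by (simp add: filterlim_at p_def[abs_def])
  from filterlim_compose[OF _ this, of "\<lambda>x. f x / x"] have "(\<lambda>n. f (p n) / p n) \<longlonglongrightarrow> D"
    using deriv \<open>f 0 = 0\<close> by (simp add: has_field_derivative_iff)
  with power_times_iterated_power_tendsto_0[OF k q(1)]
  have "(\<lambda>n. c ^ n * p n * (f (p n) / p n)) \<longlonglongrightarrow> 0 * D"
    unfolding p_def by (rule tendsto_mult)
  moreover have "c ^ n * p n * (f (p n) / p n) = f q" for n
    using p(1)[of n] iterate[of n] by simp
  ultimately have "(\<lambda>n. f q) \<longlonglongrightarrow> 0"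
    by simp
  then show ?thesis
    by (simp add: LIMSEQ_const_iff)
qed

section \<open>Theta products\<close>

definition theta_prod :: "complex \<Rightarrow> complex \<Rightarrow> complex" where
  "theta_prod x q = qpoch_inf x q * qpoch_inf (q / x) q"

definition theta_tail :: "nat \<Rightarrow> nat \<Rightarrow> complex \<Rightarrow> complex \<Rightarrow> complex" where
  "theta_tail m n x q = qpoch_inf (x * q ^ m) q * qpoch_inf (q ^ n / x) q"

lemma holomorphic_theta_prod [holomorphic_intros]:
  assumes "x holomorphic_on A" "q holomorphic_on A" "open A"
    and "\<And>z. z \<in> A \<Longrightarrow> norm (q z) < 1" "\<And>z. z \<in> A \<Longrightarrow> x z \<noteq> 0"
  shows "(\<lambda>z. theta_prod (x z) (q z)) holomorphic_on A"
  unfolding theta_prod_def using assms by (intro holomorphic_intros) auto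

lemma holomorphic_theta_tail [holomorphic_intros]:
  assumes "x holomorphic_on A" "q holomorphic_on A" "open A"
    and "\<And>z. z \<in> A \<Longrightarrow> norm (q z) < 1" "\<And>z. z \<in> A \<Longrightarrow> x z \<noteq> 0"
  shows "(\<lambda>z. theta_tail m n (x z) (q z)) holomorphic_on A"
  unfolding theta_tail_def using assms by (intro holomorphic_intros) auto

lemma theta_prod_eq_tail:
  assumes "norm q < 1"
  shows "theta_prod x q = qpoch x q m * qpoch (q / x) q n * theta_tail m (n + 1) x q"
  using qpoch_inf_split[OF assms, of x m] qpoch_inf_split[OF assms, of "q / x" n]
  by (simp add: theta_prod_def theta_tail_def)

lemma theta_prod_eq_tail_1:
  assumes "norm q < 1"
  shows "theta_prod x q = (1 - x) * theta_tail 1 1 x q"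
  using theta_prod_eq_tail[OF assms, of x 1 0] by (simp add: qpoch_Suc)

lemma theta_tail_step:
  assumes "norm q < 1"
  shows "theta_tail m n x q = (1 - x * q ^ m) * theta_tail (m + 1) n x q"
    and "theta_tail m n x q = (1 - q ^ n / x) * theta_tail m (n + 1) x q"
  using qpoch_inf_step[OF assms, of "x * q ^ m"] qpoch_inf_step[OF assms, of "q ^ n / x"]
  by (simp_all add: theta_tail_def mult_ac)

lemma theta_tail_1_nonzero:
  assumes "norm q < 1" "norm q < norm x" "norm x * norm q < 1"
  shows "theta_tail 1 1 x q \<noteq> 0"
proof -
  have "norm x > 0"
    using assms(2) norm_ge_zero[of q] by linarith
  have "norm (q / x) < 1" "norm (x * q) < 1"
    using assms \<open>norm x > 0\<close> by (simp_all add: norm_divide norm_mult)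
  then show ?thesis
    using assms(1) by (simp add: theta_tail_def qpoch_inf_nonzero)
qed

lemma theta_prod_nonzero:
  assumes "norm q < 1" "norm q < norm x" "norm x * norm q < 1" "x \<noteq> 1"
  shows "theta_prod x q \<noteq> 0"
  using theta_tail_1_nonzero[OF assms(1-3)] assms by (simp add: theta_prod_eq_tail_1)

lemma theta_prod_1 [simp]:
  assumes "norm q < 1"
  shows "theta_prod 1 q = 0"
  by (simp add: theta_prod_eq_tail_1[OF assms])

lemma theta_prod_shift:
  assumes "norm q < 1" "q \<noteq> 0" "x \<noteq> 0"
  shows "theta_prod (q * x) q = - theta_prod x q / x"
proof -
  have "theta_prod (q * x) q = (1 - 1 / x) * theta_tail 1 1 x q"
    using theta_tail_step(2)[OF assms(1), of 1 0 x] assms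
    by (simp add: theta_prod_def theta_tail_def mult_ac)
  then show ?thesis
    using assms by (simp add: theta_prod_eq_tail_1 field_simps)
qed

lemma theta_prod_reflect:
  assumes "q \<noteq> 0" "x \<noteq> 0"
  shows "theta_prod (q / x) q = theta_prod x q"
  using assms by (simp add: theta_prod_def)

text \<open>The zeros of \<open>theta_prod\<close> are the powers of \<open>q\<close>, all equivalent to \<open>x = 1\<close> under the shift, so
  the quotient \<open>f x / theta_prod x q\<close> extends holomorphically and is multiplicatively periodic.\<close>

lemma theta_prod_unique_annulus:
  assumes q: "norm q < 1" "q \<noteq> 0" and hol: "f holomorphic_on - {0}"
    and shift: "\<And>x. x \<noteq> 0 \<Longrightarrow> f (q * x) = - f x / x" and "f 1 = 0"
  defines "A \<equiv> {x. norm q < norm x \<and> norm x < 1 / norm q}"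
  shows "\<exists>c. \<forall>x\<in>A. f x = c * theta_prod x q"
proof -
  define g where "g x = (if x = 1 then deriv f 1 else (f x - f 1) / (x - 1))" for x
  define h where "h x = - g x / theta_tail 1 1 x q" for x
  have annulus: "x \<noteq> 0" "norm q < norm x" "norm x * norm q < 1" if "x \<in> A" for x
    using that q by (auto simp: A_def field_simps)
  have f_eq: "f x = h x * theta_prod x q" if "x \<in> A" for x
    using theta_tail_1_nonzero[OF q(1) annulus(2,3)[OF that]] \<open>f 1 = 0\<close>
    by (simp add: h_def g_def theta_prod_eq_tail_1[OF q(1)] field_simps)
  have "h constant_on A"
    unfolding A_def
  proof (rule multiplicatively_periodic_constant_annulus[OF q(2,1)], fold A_def)
    have "g holomorphic_on - {0}"
      unfolding g_def using hol by (intro pole_lemma_open) auto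
    then have "g holomorphic_on A"
      by (rule holomorphic_on_subset) (use annulus(1) in auto)
    moreover have "open A"
      unfolding A_def by (intro open_Collect_conj open_Collect_less continuous_intros)
    ultimately show "h holomorphic_on A"
      unfolding h_def using annulus theta_tail_1_nonzero q(1) by (intro holomorphic_intros) auto
    fix x :: complex assume x: "1 < norm x" "norm x < 1 / norm q"
    then have "norm (q * x) < 1" "norm q < norm (q * x)" "1 < 1 / norm q"
      using q by (simp_all add: norm_mult field_simps)
    with x q(1) have "x \<in> A" "q * x \<in> A" "x \<noteq> 0" "x \<noteq> 1" "q * x \<noteq> 1"
      by (auto simp: A_def)
    then show "h (q * x) = h x"
      using f_eq[of x] f_eq[of "q * x"] theta_prod_nonzero[OF q(1) annulus(2,3)]
        shift[of x] theta_prod_shift[OF q, of x] by simp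
  qed
  with f_eq show ?thesis
    by (auto simp: constant_on_def)
qed

lemma theta_prod_unique:
  assumes q: "norm q < 1" "q \<noteq> 0" and hol: "f holomorphic_on - {0}"
    and shift: "\<And>x. x \<noteq> 0 \<Longrightarrow> f (q * x) = - f x / x" and "f 1 = 0"
  shows "\<exists>c. \<forall>x. x \<noteq> 0 \<longrightarrow> f x = c * theta_prod x q"
proof -
  obtain c where on_annulus:
    "\<And>x. norm q < norm x \<Longrightarrow> norm x < 1 / norm q \<Longrightarrow> f x = c * theta_prod x q"
    using theta_prod_unique_annulus[OF assms] by blast
  have "f x = c * theta_prod x q" if "x \<noteq> 0" for x
    using q(2,1) that
  proof (rule multiplicative_shift_induct)
    show "f (q * y) = c * theta_prod (q * y) q \<longleftrightarrow> f y = c * theta_prod y q" if "y \<noteq> 0" for y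
      unfolding shift[OF that] theta_prod_shift[OF q that] using that by (auto simp: field_simps)
    have "1 < 1 / norm q"
      using q by simp
    then show "f y = c * theta_prod y q" if "norm q < norm y" "norm y \<le> 1" for y
      using that by (intro on_annulus) auto
  qed
  then show ?thesis
    by blast
qed

lemma theta_prod_mult_minus:
  assumes "norm q < 1"
  shows "theta_prod x q * theta_prod (- x) q = theta_prod (x\<^sup>2) (q\<^sup>2)"
  using qpoch_inf_mult_minus[OF assms, of x] qpoch_inf_mult_minus[OF assms, of "q / x"]
  by (simp add: theta_prod_def power_divide algebra_simps)

lemma theta_prod_odd:
  assumes "norm q < 1" "q \<noteq> 0"
  shows "theta_prod q (q\<^sup>2) = (qJ 1 q / qJ 2 q)\<^sup>2"
  using qpoch_inf_odd[OF assms(1)] assms(2) by (simp add: theta_prod_def power2_eq_square)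

lemma theta_prod_minus_odd:
  assumes "norm q < 1" "q \<noteq> 0"
  shows "theta_prod (- q) (q\<^sup>2) = ((qJ 2 q)\<^sup>2 / (qJ 1 q * qJ 4 q))\<^sup>2"
  using qpoch_inf_minus_odd[OF assms(1)] assms(2) by (simp add: theta_prod_def power2_eq_square)

lemma theta_prod_ii_odd:
  assumes "norm q < 1" "q \<noteq> 0"
  shows "theta_prod (\<i> * q) (q\<^sup>2) = (qJ 4 q)\<^sup>2 / (qJ 2 q * qJ 8 q)"
    and "theta_prod (- (\<i> * q)) (q\<^sup>2) = (qJ 4 q)\<^sup>2 / (qJ 2 q * qJ 8 q)"
proof -
  have q2: "norm (q\<^sup>2) < 1"
    using assms by (simp add: norm_power_less_one)
  have prod: "qpoch_inf (\<i> * q) (q\<^sup>2) * qpoch_inf (- (\<i> * q)) (q\<^sup>2) =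
      (qJ 4 q)\<^sup>2 / (qJ 2 q * qJ 8 q)"
    using qpoch_inf_mult_minus[OF q2, of "\<i> * q"] qpoch_inf_minus_odd[OF q2]
    by (simp add: qJ_power power_mult_distrib)
  have "q\<^sup>2 / (\<i> * q) = - (\<i> * q)" "q\<^sup>2 / (- (\<i> * q)) = \<i> * q"
    using assms(2) by (simp_all add: field_simps power2_eq_square)
  with prod show "theta_prod (\<i> * q) (q\<^sup>2) = (qJ 4 q)\<^sup>2 / (qJ 2 q * qJ 8 q)"
    and "theta_prod (- (\<i> * q)) (q\<^sup>2) = (qJ 4 q)\<^sup>2 / (qJ 2 q * qJ 8 q)"
    by (simp_all add: theta_prod_def mult.commute)
qed

lemma theta_prod_minus_one:
  assumes "norm q < 1"
  shows "theta_prod (- 1) q = 2 * (qJ 2 q / qJ 1 q)\<^sup>2"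
  using qpoch_inf_minus_self[OF assms] qpoch_inf_step[OF assms, of "- 1"]
  by (simp add: theta_prod_def power2_eq_square)

lemma theta_prod_ii:
  assumes "norm q < 1"
  shows "theta_prod \<i> q = (1 - \<i>) * (qJ 4 q / qJ 2 q)"
proof -
  have q2: "norm (q\<^sup>2) < 1"
    using assms by (simp add: norm_power_less_one)
  have "qpoch_inf (\<i> * q) q * qpoch_inf (- (\<i> * q)) q = qJ 4 q / qJ 2 q"
    using qpoch_inf_mult_minus[OF assms, of "\<i> * q"] qpoch_inf_minus_self[OF q2]
    by (simp add: qJ_power power_mult_distrib)
  moreover have "q / \<i> = - (\<i> * q)"
    by (simp add: field_simps)
  ultimately show ?thesis
    using qpoch_inf_step[OF assms, of \<i>] by (simp add: theta_prod_def mult.assoc)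
qed

lemma theta_prod_power4:
  assumes "norm q < 1" "q \<noteq> 0"
  shows "theta_prod q (q ^ 4) = qJ 1 q / qJ 2 q"
    and "theta_prod (- q) (q ^ 4) = (qJ 2 q)\<^sup>2 / (qJ 1 q * qJ 4 q)"
proof -
  have q2: "norm (q\<^sup>2) < 1"
    using assms by (simp add: norm_power_less_one)
  have "theta_prod x (q ^ 4) = qpoch_inf x (q\<^sup>2)" if "x\<^sup>2 = q\<^sup>2" for x
  proof -
    have "x \<noteq> 0" "q ^ 4 = x * x * q\<^sup>2"
      using that assms(2) by (auto simp: power2_eq_square eval_nat_numeral)
    then have "q ^ 4 / x = x * q\<^sup>2"
      by simp
    then show ?thesis
      using qpoch_inf_square[OF q2, of x] by (simp add: theta_prod_def)
  qed
  then show "theta_prod q (q ^ 4) = qJ 1 q / qJ 2 q"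
    and "theta_prod (- q) (q ^ 4) = (qJ 2 q)\<^sup>2 / (qJ 1 q * qJ 4 q)"
    by (simp_all add: qpoch_inf_odd qpoch_inf_minus_odd assms(1))
qed

lemma theta_prod_minus_cube:
  assumes "q \<noteq> 0"
  shows "theta_prod (- (q ^ 3)) (q ^ 4) = theta_prod (- q) (q ^ 4)"
proof -
  have "q ^ 4 / (- q) = - (q ^ 3)"
    using assms by (simp add: field_simps eval_nat_numeral)
  then show ?thesis
    using theta_prod_reflect[of "q ^ 4" "- q"] assms by simp
qed

lemma theta_prod_bisection:
  assumes q: "norm q < 1" "q \<noteq> 0" and "x \<noteq> 0"
  shows "qJ 1 q * theta_prod x q =
    qJ 4 q * (theta_prod (- q * x\<^sup>2) (q ^ 4) - x * theta_prod (- (q ^ 3) * x\<^sup>2) (q ^ 4))"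
proof -
  have q4: "norm (q ^ 4) < 1" "q ^ 4 \<noteq> 0"
    using q by (simp_all add: norm_power_less_one)
  define f where "f x = theta_prod (- q * x\<^sup>2) (q ^ 4)
      - x * theta_prod (- (q ^ 3) * x\<^sup>2) (q ^ 4)" for x
  have "\<exists>c. \<forall>y. y \<noteq> 0 \<longrightarrow> f y = c * theta_prod y q"
  proof (rule theta_prod_unique[OF q])
    show "f holomorphic_on - {0}"
      unfolding f_def using q q4 by (intro holomorphic_intros) auto
    show "f (q * x) = - f x / x" if "x \<noteq> 0" for x
    proof -
      have args: "- q * (q * x)\<^sup>2 = - (q ^ 3) * x\<^sup>2" "- (q ^ 3) * (q * x)\<^sup>2 = q ^ 4 * (- q * x\<^sup>2)"
        by (simp_all add: power_mult_distrib eval_nat_numeral mult_ac)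
      have "- q * x\<^sup>2 \<noteq> 0"
        using q that by simp
      then show ?thesis
        unfolding f_def args theta_prod_shift[OF q4 \<open>- q * x\<^sup>2 \<noteq> 0\<close>] using q that
        by (simp add: field_simps power2_eq_square)
    qed
    show "f 1 = 0"
      by (simp add: f_def theta_prod_minus_cube q(2))
  qed
  then obtain c where c: "f y = c * theta_prod y q" if "y \<noteq> 0" for y
    by blast
  have "2 * (qJ 2 q)\<^sup>2 / (qJ 1 q * qJ 4 q) = c * (2 * (qJ 2 q / qJ 1 q)\<^sup>2)"
    using c[of "- 1"]
    by (simp add: f_def theta_prod_minus_cube q(2) theta_prod_power4(2)[OF q]
        theta_prod_minus_one[OF q(1)])
  then have "qJ 1 q = qJ 4 q * c"
    using qJ_nonzero[OF q(1)] by (simp add: field_simps power2_eq_square)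
  then show ?thesis
    using c[OF \<open>x \<noteq> 0\<close>] by (simp add: f_def)
qed

section \<open>Ramanujan's theta function \<open>\<phi>\<close>\<close>

definition phi :: "complex \<Rightarrow> complex" where
  "phi q = qJ 2 q ^ 5 / ((qJ 1 q)\<^sup>2 * (qJ 4 q)\<^sup>2)"

lemma phi_eq_theta_prod:
  assumes "norm q < 1" "q \<noteq> 0"
  shows "phi q = qJ 2 q * theta_prod (- q) (q\<^sup>2)"
  using theta_prod_minus_odd[OF assms] qJ_nonzero[OF assms(1)]
  by (simp add: phi_def field_simps eval_nat_numeral)

lemma phi_minus:
  assumes "norm q < 1" "q \<noteq> 0"
  shows "phi (- q) = (qJ 1 q)\<^sup>2 / qJ 2 q"
proof -
  have "qJ 2 (- q) = qJ 2 q"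
    by (simp add: qJ_def)
  then show ?thesis
    using phi_eq_theta_prod[of "- q"] theta_prod_odd[OF assms] assms qJ_nonzero[OF assms(1)]
    by (simp add: field_simps power2_eq_square)
qed

lemma phi_bisection:
  assumes q: "norm q < 1" "q \<noteq> 0"
  shows "phi q = phi (q ^ 4) + 2 * q * ((qJ 16 q)\<^sup>2 / qJ 8 q)"
proof -
  have q2: "norm (q\<^sup>2) < 1" "q\<^sup>2 \<noteq> 0" and q4: "norm (q ^ 4) < 1" "q ^ 4 \<noteq> 0"
    and q8: "norm (q ^ 8) < 1" "q ^ 8 \<noteq> 0"
    using assms by (simp_all add: norm_power_less_one)
  have "qJ 2 q * theta_prod (- q) (q\<^sup>2) =
      qJ 8 q * (theta_prod (- (q ^ 4)) (q ^ 8) + q * theta_prod (- (q ^ 8)) (q ^ 8))"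
    using theta_prod_bisection[OF q2, of "- q"] q(2)
    by (simp add: qJ_power flip: power_mult power_add)
  also have "theta_prod (- (q ^ 8)) (q ^ 8) = 2 * (qJ 16 q / qJ 8 q)\<^sup>2"
    using theta_prod_reflect[OF q8(2), of "- 1"] theta_prod_minus_one[OF q8(1)]
    by (simp add: qJ_power)
  also have "qJ 8 q * (theta_prod (- (q ^ 4)) (q ^ 8) + q * (2 * (qJ 16 q / qJ 8 q)\<^sup>2)) =
      qJ 2 (q ^ 4) * theta_prod (- (q ^ 4)) ((q ^ 4)\<^sup>2) + 2 * q * ((qJ 16 q)\<^sup>2 / qJ 8 q)"
    using qJ_nonzero[OF q(1), of 8]
    by (simp add: qJ_power field_simps power2_eq_square flip: power_mult power_add)
  finally show ?thesis
    by (simp only: phi_eq_theta_prod[OF q] phi_eq_theta_prod[OF q4])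
qed

lemma phi_minus_bisection:
  assumes "norm q < 1" "q \<noteq> 0"
  shows "phi (- q) = phi (q ^ 4) - 2 * q * ((qJ 16 q)\<^sup>2 / qJ 8 q)"
  using phi_bisection[of "- q"] assms by (simp add: qJ_def)

lemma phi_mult_phi_minus:
  assumes "norm q < 1" "q \<noteq> 0"
  shows "phi q * phi (- q) = (phi (- (q\<^sup>2)))\<^sup>2"
proof -
  have minus_square: "phi (- (q\<^sup>2)) = (qJ 2 q)\<^sup>2 / qJ 4 q"
    using phi_minus[of "q\<^sup>2"] assms by (simp add: norm_power_less_one qJ_power)
  show ?thesis
    unfolding minus_square phi_minus[OF assms] phi_def[of q] using qJ_nonzero[OF assms(1)]
    by (simp add: field_simps eval_nat_numeral)
qed

lemma phi_square_sum:
  assumes "norm q < 1" "q \<noteq> 0"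
  shows "(phi q)\<^sup>2 + (phi (- q))\<^sup>2 = 2 * (phi (q\<^sup>2))\<^sup>2"
proof -
  define u where "u q = (phi q)\<^sup>2 + (phi (- q))\<^sup>2 - 2 * (phi (q\<^sup>2))\<^sup>2" for q
  have phi_hol: "phi holomorphic_on ball 0 1"
    unfolding phi_def[abs_def] using qJ_nonzero by (intro holomorphic_intros) auto
  have comp: "(\<lambda>q. phi (f q)) holomorphic_on ball 0 1"
    if "f holomorphic_on ball 0 1" "f ` ball 0 1 \<subseteq> ball 0 1" for f
    using holomorphic_on_compose_gen[OF that(1) phi_hol that(2)] by (simp add: o_def)
  have "u holomorphic_on ball 0 1"
    unfolding u_def by (intro holomorphic_intros comp phi_hol) (auto simp: norm_power_less_one)
  then have "(u has_field_derivative deriv u 0) (at 0)"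
    by (rule holomorphic_derivI) auto
  moreover have "u 0 = 0"
    by (simp add: u_def phi_def)
  moreover have "u q = - 2 * u (q\<^sup>2)" if q: "q \<noteq> 0" "norm q < 1" for q
  proof -
    have "(phi q)\<^sup>2 + (phi (- q))\<^sup>2 = (phi q + phi (- q))\<^sup>2 - 2 * (phi q * phi (- q))"
      by (simp add: power2_eq_square algebra_simps)
    also have "phi q + phi (- q) = 2 * phi (q ^ 4)"
      using phi_bisection[OF q(2,1)] phi_minus_bisection[OF q(2,1)] by simp
    finally show ?thesis
      using phi_mult_phi_minus[OF q(2,1)]
      by (simp add: u_def power_mult_distrib algebra_simps flip: power_mult)
  qed
  ultimately have "u q = 0"
    using functional_equation_imp_zero[of u "deriv u 0" "- 2" 2 q] assms by simp
  then show ?thesis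
    by (simp add: u_def)
qed

lemma phi_square_bisection:
  assumes "norm q < 1" "q \<noteq> 0"
  shows "(phi q)\<^sup>2 = (phi (q\<^sup>2))\<^sup>2 + 4 * q * (qJ 8 q ^ 4 / (qJ 4 q)\<^sup>2)"
proof -
  have "(phi q)\<^sup>2 - (phi (- q))\<^sup>2 = (phi q + phi (- q)) * (phi q - phi (- q))"
    by (simp add: power2_eq_square algebra_simps)
  also have "\<dots> = (2 * phi (q ^ 4)) * (4 * q * ((qJ 16 q)\<^sup>2 / qJ 8 q))"
    unfolding phi_bisection[OF assms] phi_minus_bisection[OF assms] by simp
  also have "phi (q ^ 4) = qJ 8 q ^ 5 / ((qJ 4 q)\<^sup>2 * (qJ 16 q)\<^sup>2)"
    by (simp add: phi_def qJ_power)
  finally have "(phi q)\<^sup>2 - (phi (- q))\<^sup>2 = 2 * (4 * q * (qJ 8 q ^ 4 / (qJ 4 q)\<^sup>2))"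
    using qJ_nonzero[OF assms(1)] by (simp add: field_simps eval_nat_numeral)
  with phi_square_sum[OF assms] show ?thesis
    by algebra
qed

section \<open>The universal mock theta function\<close>

text \<open>\<open>mock_num\<close> and \<open>rank_num\<close> are the Eulerian series of the universal mock theta function and of
  the rank function multiplied termwise by \<open>theta_prod\<close>, which removes all their poles in \<open>x \<noteq> 0\<close>.\<close>

definition mock_num :: "complex \<Rightarrow> complex \<Rightarrow> complex" where
  "mock_num x q = (\<Sum>n. q ^ (n * (n + 1)) * theta_tail (n + 1) (n + 2) x q)"

definition rank_num :: "complex \<Rightarrow> complex \<Rightarrow> complex" where
  "rank_num x q = (\<Sum>n. q ^ (n\<^sup>2) * theta_tail (n + 1) (n + 1) x q)"

lemma norm_theta_tail_le:
  assumes "norm q \<le> r" "r < 1" "norm x \<le> B" "norm (inverse x) \<le> B"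
  shows "norm (theta_tail m n x q) \<le> (exp (B / (1 - r)))\<^sup>2"
proof -
  have "norm (qpoch_inf (a * q ^ k) q) \<le> exp (B / (1 - r))" if "norm a \<le> B" for a k
  proof -
    have "norm (a * q ^ k) \<le> norm a"
      using assms(1,2) by (simp add: norm_mult norm_power mult_left_le power_le_one)
    then have "norm (a * q ^ k) / (1 - norm q) \<le> B / (1 - r)"
      using that assms(1,2) order_trans[OF norm_ge_zero that] by (intro frac_le) auto
    with norm_qpoch_inf_le[of q "a * q ^ k"] assms(1,2) show ?thesis
      by (meson exp_le_cancel_iff le_less_trans order_trans)
  qed
  from this[OF assms(3), of m] this[OF assms(4), of n] show ?thesis
    unfolding theta_tail_def norm_mult power2_eq_square
    by (intro mult_mono) (auto simp: divide_inverse mult.commute)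
qed

lemma norm_power_mult_theta_tail_le:
  assumes "norm q \<le> r" "r < 1" "norm x \<le> B" "norm (inverse x) \<le> B" "k \<le> e"
  shows "norm (q ^ e * theta_tail m n x q) \<le> r ^ k * (exp (B / (1 - r)))\<^sup>2"
proof -
  have "norm q ^ e \<le> norm q ^ k"
    using assms by (intro power_decreasing) auto
  also have "norm q ^ k \<le> r ^ k"
    using assms(1) by (intro power_mono) auto
  finally show ?thesis
    using norm_theta_tail_le[OF assms(1-4)] order_trans[OF norm_ge_zero assms(1)]
    unfolding norm_mult norm_power by (intro mult_mono) auto
qed

lemma summable_theta_tail:
  assumes "norm q < 1" "\<And>k. k \<le> e k"
  shows "summable (\<lambda>k. q ^ e k * theta_tail (m k) (n k) x q)"
proof (rule summable_comparison_test')
  let ?B = "max (norm x) (norm (inverse x))"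
  show "summable (\<lambda>k. norm q ^ k * (exp (?B / (1 - norm q)))\<^sup>2)"
    using assms(1) by (intro summable_mult2 summable_geometric) auto
  show "norm (q ^ e k * theta_tail (m k) (n k) x q) \<le>
      norm q ^ k * (exp (?B / (1 - norm q)))\<^sup>2" for k
    by (rule norm_power_mult_theta_tail_le) (use assms in auto)
qed

lemma summable_mock_num:
  assumes "norm q < 1"
  shows "summable (\<lambda>n. q ^ (n * (n + 1)) * theta_tail (n + 1) (n + 2) x q)"
  by (rule summable_theta_tail[OF assms]) simp

lemma summable_rank_num:
  assumes "norm q < 1"
  shows "summable (\<lambda>n. q ^ (n\<^sup>2) * theta_tail (n + 1) (n + 1) x q)"
  by (rule summable_theta_tail[OF assms]) (simp add: power2_eq_square)

lemma holomorphic_mock_num [holomorphic_intros]: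
  assumes x: "x holomorphic_on A" and q: "q holomorphic_on A" and "open A"
    and q_less: "\<And>z. z \<in> A \<Longrightarrow> norm (q z) < 1" and x_nz: "\<And>z. z \<in> A \<Longrightarrow> x z \<noteq> 0"
  shows "(\<lambda>z. mock_num (x z) (q z)) holomorphic_on A"
proof (rule holomorphic_uniform_sequence[OF \<open>open A\<close>])
  let ?f = "\<lambda>n z. q z ^ (n * (n + 1)) * theta_tail (n + 1) (n + 2) (x z) (q z)"
  show "(\<lambda>z. \<Sum>k<n. ?f k z) holomorphic_on A" for n
    by (intro holomorphic_intros assms)
  have "continuous_on A x" "continuous_on A q"
    using x q by (auto intro: holomorphic_on_imp_continuous_on)
  then have cont: "continuous_on A (\<lambda>z. max (norm (x z)) (norm (inverse (x z))))"
      "continuous_on A q"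
    using x_nz by (auto intro!: continuous_intros)
  fix z assume "z \<in> A"
  then obtain d r B where d: "d > 0" "cball z d \<subseteq> A" and "r < 1"
    and B: "\<forall>w\<in>cball z d. norm (max (norm (x w)) (norm (inverse (x w)))) \<le> B"
    and r: "\<forall>w\<in>cball z d. norm (q w) \<le> r"
    by (rule cball_norm_bounds[OF \<open>open A\<close> _ cont q_less])
  have "r \<ge> 0"
    using d(1) r order_trans[OF norm_ge_zero, of "q z"] by simp
  have "uniform_limit (cball z d) (\<lambda>n w. \<Sum>k<n. ?f k w) (\<lambda>w. \<Sum>k. ?f k w) sequentially"
  proof (rule Weierstrass_m_test)
    show "summable (\<lambda>k. r ^ k * (exp (B / (1 - r)))\<^sup>2)"
      using \<open>r < 1\<close> \<open>r \<ge> 0\<close> by (intro summable_mult2 summable_geometric) auto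
    show "norm (?f k w) \<le> r ^ k * (exp (B / (1 - r)))\<^sup>2" if "w \<in> cball z d" for k w
      using B r that \<open>r < 1\<close> by (intro norm_power_mult_theta_tail_le) force+
  qed
  then show "\<exists>d>0. cball z d \<subseteq> A \<and>
      uniform_limit (cball z d) (\<lambda>n w. \<Sum>k<n. ?f k w) (\<lambda>w. mock_num (x w) (q w)) sequentially"
    unfolding mock_num_def using d by blast
qed

lemma mock_num_reflect:
  assumes "q \<noteq> 0" "x \<noteq> 0"
  shows "mock_num (q / x) q = mock_num x q"
  using assms by (simp add: mock_num_def theta_tail_def mult_ac)

lemma rank_num_inverse:
  assumes "x \<noteq> 0"
  shows "rank_num (1 / x) q = rank_num x q"
  using assms by (simp add: rank_num_def theta_tail_def mult_ac)

lemma rank_num_eq: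
  assumes "norm q < 1" "x \<noteq> 0"
  shows "rank_num x q = theta_prod x q + x * mock_num x q"
proof -
  define t where "t n = q ^ (n\<^sup>2) * theta_tail n (n + 1) x q" for n
  have "t \<longlonglongrightarrow> 0"
    unfolding t_def
    by (rule summable_LIMSEQ_zero[OF summable_theta_tail[OF assms(1)]]) (simp add: power2_eq_square)
  then have "(\<lambda>n. t n - t (Suc n)) sums (t 0 - 0)"
    by (rule telescope_sums')
  moreover have "t n - t (Suc n) = q ^ (n\<^sup>2) * theta_tail (n + 1) (n + 1) x q
      - x * (q ^ (n * (n + 1)) * theta_tail (n + 1) (n + 2) x q)" for n
  proof -
    have "t n = q ^ (n\<^sup>2) * ((1 - x * q ^ n) * theta_tail (n + 1) (n + 1) x q)"
      unfolding t_def theta_tail_step(1)[OF assms(1), of n] ..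
    moreover have "x * theta_tail (n + 1) (n + 1) x q =
        (x - q ^ (n + 1)) * theta_tail (n + 1) (n + 2) x q"
      using theta_tail_step(2)[OF assms(1), of "n + 1" "n + 1" x] assms(2)
      by (simp add: field_simps)
    moreover have "t (Suc n) = q ^ (n\<^sup>2) * q ^ n * q ^ (n + 1) * theta_tail (n + 1) (n + 2) x q"
      by (simp add: t_def power2_eq_square power_add algebra_simps)
    moreover have "q ^ (n * (n + 1)) = q ^ (n\<^sup>2) * q ^ n"
      by (simp add: power2_eq_square power_add)
    moreover have "Y * ((1 - x * u) * S) - Y * u * v * T = Y * S - x * (Y * u * T)"
      if "x * S = (x - v) * T" for Y u v S T
      using that by algebra
    ultimately show ?thesis
      by (simp only:)
  qed
  ultimately have "(\<lambda>n. q ^ (n\<^sup>2) * theta_tail (n + 1) (n + 1) x q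
      - x * (q ^ (n * (n + 1)) * theta_tail (n + 1) (n + 2) x q)) sums t 0"
    by simp
  moreover have "(\<lambda>n. q ^ (n\<^sup>2) * theta_tail (n + 1) (n + 1) x q
      - x * (q ^ (n * (n + 1)) * theta_tail (n + 1) (n + 2) x q)) sums
        (rank_num x q - x * mock_num x q)"
    unfolding rank_num_def mock_num_def
    by (intro sums_diff sums_mult summable_sums summable_mock_num summable_rank_num assms(1))
  ultimately have "t 0 = rank_num x q - x * mock_num x q"
    by (rule sums_unique2)
  then show ?thesis
    by (simp add: t_def theta_tail_def theta_prod_def algebra_simps)
qed

lemma mock_num_shift:
  assumes "norm q < 1" "q \<noteq> 0" "x \<noteq> 0"
  shows "mock_num (q * x) q = (1 + x) * theta_prod x q + x\<^sup>2 * mock_num x q"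
proof -
  have "rank_num (1 / x) q = theta_prod (1 / x) q + 1 / x * mock_num (1 / x) q"
    using assms by (intro rank_num_eq) auto
  moreover have "rank_num (1 / x) q = theta_prod x q + x * mock_num x q"
    using rank_num_eq[OF assms(1,3)] rank_num_inverse[OF assms(3)] by simp
  moreover have "mock_num (1 / x) q = mock_num (q * x) q"
    using mock_num_reflect[of q "q * x"] assms by simp
  moreover have "theta_prod (1 / x) q = - theta_prod x q / x"
    using theta_prod_reflect[of q "q * x"] theta_prod_shift[OF assms] assms by simp
  ultimately show ?thesis
    using assms by (simp add: field_simps power2_eq_square)
qed

lemma mock_num_0_right:
  assumes "x \<noteq> 0"
  shows "mock_num x 0 = 1"
  unfolding mock_num_def by (subst suminf_finite[of "{0}"]) (auto simp: theta_tail_def)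

definition mock_bisection :: "complex \<Rightarrow> complex \<Rightarrow> complex" where
  "mock_bisection x q = theta_prod (- q * x\<^sup>2) (q ^ 4) *
     (theta_prod (- x) q * mock_num x q + theta_prod x q * mock_num (- x) q)
     + 2 * q * theta_prod x q * theta_prod (- x) q * mock_num (- q * x\<^sup>2) (q ^ 4)"

definition mock_bisection_const :: "complex \<Rightarrow> complex" where
  "mock_bisection_const q = 2 * qJ 2 q ^ 4 / ((qJ 1 q)\<^sup>2 * qJ 4 q)"

lemma mock_bisection_shift:
  assumes q: "norm q < 1" "q \<noteq> 0" and "x \<noteq> 0"
  shows "mock_bisection (q\<^sup>2 * x) q = mock_bisection x q"
proof -
  have q4: "norm (q ^ 4) < 1" "q ^ 4 \<noteq> 0"
    using q by (simp_all add: norm_power_less_one)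
  have theta_shift: "theta_prod (q\<^sup>2 * y) q = theta_prod y q / (q * y\<^sup>2)"
    and mock_shift: "mock_num (q\<^sup>2 * y) q =
      (- (1 / y) - q + q\<^sup>2 * y\<^sup>2 + q\<^sup>2 * y ^ 3) * theta_prod y q + q\<^sup>2 * y ^ 4 * mock_num y q"
    if "y \<noteq> 0" for y
  proof -
    have "q\<^sup>2 * y = q * (q * y)"
      by (simp add: power2_eq_square)
    then show "theta_prod (q\<^sup>2 * y) q = theta_prod y q / (q * y\<^sup>2)"
      and "mock_num (q\<^sup>2 * y) q =
        (- (1 / y) - q + q\<^sup>2 * y\<^sup>2 + q\<^sup>2 * y ^ 3) * theta_prod y q + q\<^sup>2 * y ^ 4 * mock_num y q"
      using q that by (simp_all add: theta_prod_shift mock_num_shift field_simps eval_nat_numeral)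
  qed
  have args: "- q * (q\<^sup>2 * x)\<^sup>2 = q ^ 4 * (- q * x\<^sup>2)" "- (q\<^sup>2 * x) = q\<^sup>2 * (- x)"
    by (simp_all add: power_mult_distrib)
  have nz: "- q * x\<^sup>2 \<noteq> 0" "- x \<noteq> 0"
    using q \<open>x \<noteq> 0\<close> by simp_all
  show ?thesis
    unfolding mock_bisection_def args theta_prod_shift[OF q4 nz(1)] mock_num_shift[OF q4 nz(1)]
      theta_shift[OF \<open>x \<noteq> 0\<close>] theta_shift[OF nz(2)] mock_shift[OF \<open>x \<noteq> 0\<close>] mock_shift[OF nz(2)]
    using q(2) \<open>x \<noteq> 0\<close> by (simp add: field_simps) algebra
qed

lemma mock_bisection_constant:
  assumes q: "norm q < 1" "q \<noteq> 0" and "x \<noteq> 0"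
  shows "mock_bisection x q = mock_bisection 1 q"
proof (rule multiplicatively_periodic_constant[where p = "q\<^sup>2"])
  show "(\<lambda>x. mock_bisection x q) holomorphic_on - {0}"
    unfolding mock_bisection_def using q by (intro holomorphic_intros norm_power_less_one) auto
qed (use assms mock_bisection_shift in \<open>auto simp: norm_power_less_one\<close>)

text \<open>By constancy, \<open>mock_bisection\<close> agrees at \<open>x = 1\<close> and at \<open>x\<^sup>2 = - 1 / q\<close>, where one of its two
  summands vanishes; so \<open>mock_num 1 q / qJ 1 q\<close> is invariant under \<open>q \<mapsto> q ^ 4\<close>.\<close>

lemma mock_num_1_power4:
  assumes q: "norm q < 1" "q \<noteq> 0"
  shows "mock_num 1 q / qJ 1 q = mock_num 1 (q ^ 4) / qJ 4 q"
proof -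
  have q2: "norm (q\<^sup>2) < 1" "q\<^sup>2 \<noteq> 0"
    using q by (simp_all add: norm_power_less_one)
  define x where "x = csqrt (- 1 / q)"
  have x: "x \<noteq> 0" "x\<^sup>2 = - 1 / q" "- q * x\<^sup>2 = 1"
    using q(2) by (simp_all add: x_def)
  have "theta_prod (- q) (q\<^sup>2) = q * theta_prod (- 1 / q) (q\<^sup>2)"
    using theta_prod_shift[OF q2, of "- 1 / q"] q(2) by (simp add: power2_eq_square)
  then have "mock_bisection x q = 2 * theta_prod (- q) (q\<^sup>2) * mock_num 1 (q ^ 4)"
    using q x theta_prod_mult_minus[OF q(1), of x]
    by (simp add: mock_bisection_def norm_power_less_one mult.assoc)
  moreover have "mock_bisection 1 q = theta_prod (- q) (q ^ 4) * theta_prod (- 1) q * mock_num 1 q"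
    using q(1) by (simp add: mock_bisection_def)
  ultimately show ?thesis
    using mock_bisection_constant[OF q x(1)] qJ_nonzero[OF q(1)]
    unfolding theta_prod_minus_odd[OF q] theta_prod_power4(2)[OF q] theta_prod_minus_one[OF q(1)]
    by (simp add: field_simps power2_eq_square)
qed

lemma mock_num_1:
  assumes "norm q < 1" "q \<noteq> 0"
  shows "mock_num 1 q = qJ 1 q"
proof -
  define f where "f q = mock_num 1 q / qJ 1 q - 1" for q
  have "f holomorphic_on ball 0 1"
    unfolding f_def using qJ_nonzero by (intro holomorphic_intros) auto
  then have "(f has_field_derivative deriv f 0) (at 0)"
    by (rule holomorphic_derivI) auto
  moreover have "f 0 = 0"
    by (simp add: f_def mock_num_0_right)
  moreover have "f q = 1 * f (q ^ 4)" if "q \<noteq> 0" "norm q < 1" for q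
    using mock_num_1_power4[OF that(2,1)] by (simp add: f_def qJ_power)
  ultimately have "f q = 0"
    using functional_equation_imp_zero[of f "deriv f 0" 1 4 q] assms by simp
  then show ?thesis
    using qJ_nonzero[OF assms(1), of 1] by (simp add: f_def)
qed

lemma mock_bisection_eq:
  assumes q: "norm q < 1" "q \<noteq> 0" and "x \<noteq> 0"
  shows "mock_bisection x q = mock_bisection_const q"
proof -
  have "mock_bisection 1 q = theta_prod (- q) (q ^ 4) * (theta_prod (- 1) q * qJ 1 q)"
    using q by (simp add: mock_bisection_def mock_num_1)
  then show ?thesis
    unfolding mock_bisection_const_def mock_bisection_constant[OF assms]
      theta_prod_minus_one[OF q(1)] theta_prod_power4(2)[OF q]
    using qJ_nonzero[OF q(1)] by (simp add: field_simps eval_nat_numeral)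
qed

lemma inverse_qpoch_mult:
  assumes "norm q < 1" "theta_prod x q \<noteq> 0"
  shows "1 / (qpoch x q m * qpoch (q / x) q n) = theta_tail m (n + 1) x q / theta_prod x q"
  using assms(2) unfolding theta_prod_eq_tail[OF assms(1), of x m n] by (simp add: field_simps)

lemma mock_g_eq:
  assumes "norm q < 1" "x \<noteq> 0" "theta_prod x q \<noteq> 0"
  shows "mock_g x q = mock_num x q / theta_prod x q"
proof -
  have "q ^ (n\<^sup>2) / (qpoch x q (n + 1) * qpoch (q / x) q n) =
      q ^ (n\<^sup>2) * theta_tail (n + 1) (n + 1) x q / theta_prod x q" for n
    using inverse_qpoch_mult[OF assms(1,3), of "n + 1" n]
      by (metis times_divide_eq_right mult_1_right)
  then have "mock_g x q = inverse x * (- 1 + rank_num x q / theta_prod x q)"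
    unfolding mock_g_def rank_num_def
    using suminf_divide[OF summable_rank_num[OF assms(1)]] by simp
  then show ?thesis
    using assms by (simp add: rank_num_eq field_simps)
qed

lemma mock_g_sums:
  assumes "norm q < 1" "x \<noteq> 0" "theta_prod x q \<noteq> 0"
  shows "(\<lambda>n. q ^ (n * (n + 1)) / (qpoch x q (n + 1) * qpoch (q / x) q (n + 1))) sums mock_g x q"
proof -
  have "q ^ (n * (n + 1)) / (qpoch x q (n + 1) * qpoch (q / x) q (n + 1)) =
      q ^ (n * (n + 1)) * theta_tail (n + 1) (n + 2) x q / theta_prod x q" for n
    using inverse_qpoch_mult[OF assms(1,3), of "n + 1" "n + 1"]
    by (metis times_divide_eq_right mult_1_right add.assoc one_add_one)
  then show ?thesis
    unfolding mock_g_eq[OF assms] mock_num_def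
    using sums_divide[OF summable_sums[OF summable_mock_num[OF assms(1)]]] by simp
qed

lemma mock_g_shift:
  assumes "norm q < 1" "q \<noteq> 0" "x \<noteq> 0" "theta_prod x q \<noteq> 0"
  shows "mock_g (q * x) q = - x - x\<^sup>2 - x ^ 3 * mock_g x q"
proof -
  note shift = theta_prod_shift[OF assms(1-3)]
  then have "mock_g (q * x) q = mock_num (q * x) q / (- theta_prod x q / x)"
    using mock_g_eq[of q "q * x"] assms by simp
  then show ?thesis
    unfolding mock_num_shift[OF assms(1-3)] mock_g_eq[OF assms(1,3,4)]
    using assms by (simp add: field_simps power2_eq_square power3_eq_cube)
qed

lemma mock_g_reflect:
  assumes "norm q < 1" "q \<noteq> 0" "x \<noteq> 0" "theta_prod x q \<noteq> 0"
  shows "mock_g (q / x) q = mock_g x q"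
  using assms mock_g_eq[of q x] mock_g_eq[of q "q / x"]
  by (simp add: theta_prod_reflect mock_num_reflect)

lemma mock_g_bisection_sum:
  assumes q: "norm q < 1" "q \<noteq> 0" and "x \<noteq> 0"
    and nz: "theta_prod (x\<^sup>2) (q\<^sup>2) \<noteq> 0" "theta_prod (- q * x\<^sup>2) (q ^ 4) \<noteq> 0"
  shows "mock_g x q + mock_g (- x) q + 2 * q * mock_g (- q * x\<^sup>2) (q ^ 4) =
    mock_bisection_const q / (theta_prod (x\<^sup>2) (q\<^sup>2) * theta_prod (- q * x\<^sup>2) (q ^ 4))"
proof -
  have nz_factors: "theta_prod x q \<noteq> 0" "theta_prod (- x) q \<noteq> 0"
    using nz(1) unfolding theta_prod_mult_minus[OF q(1), symmetric] by auto
  have mock_g: "mock_g x q = mock_num x q / theta_prod x q"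
    "mock_g (- x) q = mock_num (- x) q / theta_prod (- x) q"
    "mock_g (- q * x\<^sup>2) (q ^ 4) = mock_num (- q * x\<^sup>2) (q ^ 4) / theta_prod (- q * x\<^sup>2) (q ^ 4)"
    using assms nz_factors by (intro mock_g_eq norm_power_less_one; simp)+
  show ?thesis
    unfolding mock_bisection_eq[OF assms(1-3), symmetric] mock_bisection_def mock_g
      theta_prod_mult_minus[OF q(1), symmetric]
    using nz_factors nz(2) by (simp add: field_simps)
qed

text \<open>Apply \<open>mock_g_bisection_sum\<close> at \<open>q * x\<close>, where the shift turns the sum into a difference.\<close>

lemma mock_g_bisection_diff:
  assumes q: "norm q < 1" "q \<noteq> 0" and "x \<noteq> 0"
    and nz: "theta_prod (x\<^sup>2) (q\<^sup>2) \<noteq> 0" "theta_prod (- q / x\<^sup>2) (q ^ 4) \<noteq> 0"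
  shows "mock_g x q - mock_g (- x) q = - 2 / x + 2 * q / x ^ 3 * mock_g (- q / x\<^sup>2) (q ^ 4)
    + mock_bisection_const q /
      (x * (theta_prod (x\<^sup>2) (q\<^sup>2) * theta_prod (- q / x\<^sup>2) (q ^ 4)))"
proof -
  have q4: "norm (q ^ 4) < 1" "q ^ 4 \<noteq> 0" and q2: "norm (q\<^sup>2) < 1" "q\<^sup>2 \<noteq> 0"
    using q by (simp_all add: norm_power_less_one)
  have nz_factors: "theta_prod x q \<noteq> 0" "theta_prod (- x) q \<noteq> 0"
    using nz(1) unfolding theta_prod_mult_minus[OF q(1), symmetric] by auto
  have arg: "- q * (q * x)\<^sup>2 = q ^ 4 / (- q / x\<^sup>2)" and arg_nz: "- q / x\<^sup>2 \<noteq> 0"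
    using q \<open>x \<noteq> 0\<close> by (simp_all add: field_simps eval_nat_numeral)
  have reflect: "theta_prod (- q * (q * x)\<^sup>2) (q ^ 4) = theta_prod (- q / x\<^sup>2) (q ^ 4)"
    "mock_g (- q * (q * x)\<^sup>2) (q ^ 4) = mock_g (- q / x\<^sup>2) (q ^ 4)"
    unfolding arg using theta_prod_reflect[OF q4(2) arg_nz]
      mock_g_reflect[OF q4 arg_nz nz(2)] by auto
  have shift: "theta_prod ((q * x)\<^sup>2) (q\<^sup>2) = - theta_prod (x\<^sup>2) (q\<^sup>2) / x\<^sup>2"
    "mock_g (q * x) q = - x - x\<^sup>2 - x ^ 3 * mock_g x q"
    "mock_g (- (q * x)) q = x - x\<^sup>2 + x ^ 3 * mock_g (- x) q"
    using theta_prod_shift[OF q2, of "x\<^sup>2"] mock_g_shift[OF q _ nz_factors(1)]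
      mock_g_shift[OF q _ nz_factors(2)] \<open>x \<noteq> 0\<close> by (simp_all add: power_mult_distrib)
  define C where "C = mock_bisection_const q"
  define D where "D = theta_prod (x\<^sup>2) (q\<^sup>2) * theta_prod (- q / x\<^sup>2) (q ^ 4)"
  have "mock_g (q * x) q + mock_g (- (q * x)) q + 2 * q * mock_g (- q * (q * x)\<^sup>2) (q ^ 4) =
      C / (theta_prod ((q * x)\<^sup>2) (q\<^sup>2) * theta_prod (- q * (q * x)\<^sup>2) (q ^ 4))"
    unfolding C_def by (rule mock_g_bisection_sum) (use assms shift reflect in auto)
  then have "x ^ 3 * (mock_g x q - mock_g (- x) q) =
      - 2 * x\<^sup>2 + 2 * q * mock_g (- q / x\<^sup>2) (q ^ 4) + C * x\<^sup>2 / D"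
    unfolding shift reflect by (simp add: D_def algebra_simps)
  then have "mock_g x q - mock_g (- x) q =
      (- 2 * x\<^sup>2 + 2 * q * mock_g (- q / x\<^sup>2) (q ^ 4) + C * x\<^sup>2 / D) / x ^ 3"
    using \<open>x \<noteq> 0\<close> by (simp add: field_simps)
  also have "\<dots> = - 2 / x + 2 * q / x ^ 3 * mock_g (- q / x\<^sup>2) (q ^ 4) + C / (x * D)"
    using \<open>x \<noteq> 0\<close>
    by (simp add: add_divide_distrib diff_divide_distrib eval_nat_numeral mult.commute)
  finally show ?thesis
    by (simp add: C_def D_def)
qed

section \<open>Odd Durfee symbols\<close>

lemma has_sum_product_complex:
  fixes f :: "'a \<Rightarrow> complex" and g :: "'b \<Rightarrow> complex"
  assumes f: "(f has_sum a) A" and g: "(g has_sum b) B"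
  shows "((\<lambda>(x, y). f x * g y) has_sum (a * b)) (A \<times> B)"
proof (rule has_sum_SigmaI)
  show "((\<lambda>y. case (x, y) of (x, y) \<Rightarrow> f x * g y) has_sum (f x * b)) B" for x
    using has_sum_cmult_right[OF g, of "f x"] by simp
  show "((\<lambda>x. f x * b) has_sum (a * b)) A"
    by (rule has_sum_cmult_left[OF f])
  have "(\<lambda>x. norm (f x)) summable_on A" "(\<lambda>y. norm (g y)) summable_on B"
    using f g summable_on_iff_abs_summable_on_complex has_sum_imp_summable by blast+
  then have "(\<lambda>p. norm (case p of (x, y) \<Rightarrow> f x * g y)) summable_on (A \<times> B)"
    by (subst Infinite_Sum.abs_summable_on_Sigma_iff)
       (auto simp: norm_mult infsum_cmult_right' infsum_nonneg
         intro!: summable_on_cmult_left summable_on_cmult_right)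
  then show "(\<lambda>(x, y). f x * g y) summable_on A \<times> B"
    by (rule abs_summable_summable)
qed

lemma has_sum_sum:
  fixes f :: "'a \<Rightarrow> 'b \<Rightarrow> 'c :: topological_comm_monoid_add"
  assumes "\<And>i. i \<in> I \<Longrightarrow> (f i has_sum s i) A"
  shows "((\<lambda>x. \<Sum>i\<in>I. f i x) has_sum (\<Sum>i\<in>I. s i)) A"
  using assms by (induction I rule: infinite_finite_induct) (auto intro!: has_sum_add)

definition odd_lists :: "nat \<Rightarrow> nat list set" where
  "odd_lists d = {xs. sorted_wrt (\<ge>) xs \<and> (\<forall>x\<in>set xs. odd x \<and> x < 2 * d)}"

lemma replicate_append_filter:
  fixes xs :: "'a :: linorder list"
  assumes "sorted_wrt (\<ge>) xs" "\<forall>x\<in>set xs. x \<le> M"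
  shows "replicate (length (filter (\<lambda>x. x = M) xs)) M @ filter (\<lambda>x. x \<noteq> M) xs = xs"
  using assms
proof (induction xs)
  case (Cons x xs)
  show ?case
  proof (cases "x = M")
    case False
    with Cons.prems have "\<forall>y\<in>set xs. y \<noteq> M"
      by fastforce
    then have "filter (\<lambda>x. x = M) xs = []" "filter (\<lambda>x. x \<noteq> M) xs = xs"
      by (auto simp: filter_empty_conv filter_id_conv)
    with False show ?thesis
      by simp
  qed (use Cons in auto)
qed simp

lemma bij_betw_odd_lists_Suc:
  "bij_betw (\<lambda>(m, ys). replicate m (2 * d + 1) @ ys) (UNIV \<times> odd_lists d) (odd_lists (Suc d))"
proof (rule bij_betw_byWitness)
  let ?M = "2 * d + 1"
  let ?join = "\<lambda>(m, ys). replicate m ?M @ ys"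
  let ?split = "\<lambda>xs. (length (filter (\<lambda>x. x = ?M) xs), filter (\<lambda>x. x \<noteq> ?M) xs)"
  have "sorted_wrt (\<ge>) (replicate m ?M)" for m
    by (induction m) auto
  then show "?join ` (UNIV \<times> odd_lists d) \<subseteq> odd_lists (Suc d)"
    by (force simp: odd_lists_def sorted_wrt_append)
  have "x < 2 * d" if "odd x" "x < 2 * Suc d" "x \<noteq> ?M" for x
    using that by presburger
  then show "?split ` odd_lists (Suc d) \<subseteq> UNIV \<times> odd_lists d"
    by (auto simp: odd_lists_def intro: sorted_wrt_filter)
  show "\<forall>p\<in>UNIV \<times> odd_lists d. ?split (?join p) = p"
  proof
    fix p :: "nat \<times> nat list" assume "p \<in> UNIV \<times> odd_lists d"
    then obtain m ys where p: "p = (m, ys)" and "\<forall>y\<in>set ys. y \<noteq> ?M"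
      by (force simp: odd_lists_def)
    then have "filter (\<lambda>x. x = ?M) ys = []" "filter (\<lambda>x. x \<noteq> ?M) ys = ys"
      by (auto simp: filter_empty_conv filter_id_conv)
    then show "?split (?join p) = p"
      by (simp add: p)
  qed
  show "\<forall>xs\<in>odd_lists (Suc d). ?join (?split xs) = xs"
    by (auto simp: odd_lists_def intro!: replicate_append_filter)
qed

lemma has_sum_odd_lists:
  fixes z q :: complex
  assumes "norm z \<le> 1" "norm q < 1"
  shows "((\<lambda>xs. z ^ length xs * q ^ sum_list xs) has_sum (1 / qpoch (z * q) (q\<^sup>2) d)) (odd_lists d)"
proof (induction d)
  case 0
  have "odd_lists 0 = {[]}"
    by (auto simp: odd_lists_def neq_Nil_conv)
  then show ?case
    using has_sum_finite[of "{[]}" "\<lambda>xs. z ^ length xs * q ^ sum_list xs"] by simp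
next
  case (Suc d)
  let ?w = "z * q ^ (2 * d + 1)"
  have "norm ?w \<le> norm (q ^ (2 * d + 1))"
    using assms mult_right_mono[of "norm z" 1 "norm (q ^ (2 * d + 1))"] by (simp add: norm_mult)
  also have "\<dots> < 1"
    using assms by (intro norm_power_less_one) auto
  finally have w: "norm ?w < 1" .
  have "((\<lambda>m. ?w ^ m) has_sum (1 / (1 - ?w))) UNIV"
    using w by (intro norm_summable_imp_has_sum geometric_sums)
       (auto simp: norm_power intro: summable_geometric)
  from has_sum_product_complex[OF this Suc]
  have "((\<lambda>(m, ys). ?w ^ m * (z ^ length ys * q ^ sum_list ys)) has_sum
      (1 / (1 - ?w) * (1 / qpoch (z * q) (q\<^sup>2) d))) (UNIV \<times> odd_lists d)" .
  also have "1 / (1 - ?w) * (1 / qpoch (z * q) (q\<^sup>2) d) = 1 / qpoch (z * q) (q\<^sup>2) (Suc d)"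
    by (simp add: qpoch_Suc power_mult[symmetric] mult.assoc)
  also have "(\<lambda>(m, ys). ?w ^ m * (z ^ length ys * q ^ sum_list ys)) =
      (\<lambda>p. (\<lambda>xs. z ^ length xs * q ^ sum_list xs) ((\<lambda>(m, ys). replicate m (2 * d + 1) @ ys) p))"
    by (auto simp: fun_eq_iff sum_list_replicate power_add power_mult_distrib power_mult[symmetric]
        algebra_simps)
  finally show ?case
    by (subst (asm) has_sum_reindex_bij_betw[OF bij_betw_odd_lists_Suc])
qed

definition all_symbols :: "(nat \<times> nat list \<times> nat list) set" where
  "all_symbols = (SIGMA D:UNIV. odd_lists (D + 1) \<times> odd_lists (D + 1))"

definition symbol_size :: "nat \<times> nat list \<times> nat list \<Rightarrow> nat" where
  "symbol_size = (\<lambda>(D, as, bs). sum_list as + sum_list bs + 2 * D\<^sup>2 + 2 * D + 1)"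

lemma odd_Durfee_symbols_eq: "odd_Durfee_symbols n = {S \<in> all_symbols. symbol_size S = n}"
proof -
  have "x \<le> 2 * D + 1 \<longleftrightarrow> x < 2 * (D + 1)" for x D :: nat
    by auto
  then show ?thesis
    by (auto simp: odd_Durfee_symbols_def all_symbols_def odd_lists_def symbol_size_def)
qed

definition odd_rank_gf :: "complex \<Rightarrow> complex \<Rightarrow> complex" where
  "odd_rank_gf x q = q * mock_g (x * q) (q\<^sup>2)"

lemma theta_prod_unit_nonzero:
  assumes "norm q < 1" "q \<noteq> 0" "norm x = 1"
  shows "theta_prod (x * q) (q\<^sup>2) \<noteq> 0"
proof (rule theta_prod_nonzero)
  have "norm q ^ 3 < 1" "norm q ^ 2 < norm q ^ 1"
    using assms power_strict_decreasing[of 1 2 "norm q"] by (auto simp: power_less_one_iff)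
  then show "norm (q\<^sup>2) < norm (x * q)" "norm (x * q) * norm (q\<^sup>2) < 1"
    using assms by (simp_all add: norm_mult norm_power power2_eq_square power3_eq_cube)
  show "x * q \<noteq> 1"
    using assms by (metis less_irrefl mult_1 norm_mult norm_one)
qed (use assms in \<open>simp add: norm_power_less_one\<close>)

definition fixed_Durfee_gf :: "complex \<Rightarrow> complex \<Rightarrow> nat \<Rightarrow> complex" where
  "fixed_Durfee_gf x q D =
    q ^ (2 * D\<^sup>2 + 2 * D + 1) / (qpoch (x * q) (q\<^sup>2) (D + 1) * qpoch (q / x) (q\<^sup>2) (D + 1))"

lemma has_sum_fixed_Durfee_gf:
  fixes x q :: complex
  assumes "norm q < 1" "norm x = 1"
  shows "((\<lambda>y. x powi odd_rank (D, y) * q ^ symbol_size (D, y)) has_sum fixed_Durfee_gf x q D)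
    (odd_lists (D + 1) \<times> odd_lists (D + 1))"
proof -
  have x: "x \<noteq> 0" "norm x \<le> 1" "norm (inverse x) \<le> 1"
    using assms(2) by (auto simp: norm_inverse)
  have "((\<lambda>y. q ^ (2 * D\<^sup>2 + 2 * D + 1) * (case y of (as, bs) \<Rightarrow>
      x ^ length as * q ^ sum_list as * (inverse x ^ length bs * q ^ sum_list bs))) has_sum
      (q ^ (2 * D\<^sup>2 + 2 * D + 1) *
        (1 / qpoch (x * q) (q\<^sup>2) (D + 1) * (1 / qpoch (inverse x * q) (q\<^sup>2) (D + 1)))))
      (odd_lists (D + 1) \<times> odd_lists (D + 1))"
    by (intro has_sum_cmult_right has_sum_product_complex has_sum_odd_lists assms x)
  moreover have "(\<lambda>y. q ^ (2 * D\<^sup>2 + 2 * D + 1) * (case y of (as, bs) \<Rightarrow>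
      x ^ length as * q ^ sum_list as * (inverse x ^ length bs * q ^ sum_list bs))) =
      (\<lambda>y. x powi odd_rank (D, y) * q ^ symbol_size (D, y))"
    using x(1)
    by (auto simp: fun_eq_iff odd_rank_def symbol_size_def power_int_diff power_add field_simps)
  ultimately show ?thesis
    by (simp add: fixed_Durfee_gf_def field_simps)
qed

lemma fixed_Durfee_gf_sums:
  assumes "norm q < 1" "q \<noteq> 0" "norm x = 1"
  shows "fixed_Durfee_gf x q sums odd_rank_gf x q"
proof -
  have "x \<noteq> 0"
    using assms(3) by auto
  have "(\<lambda>D. q * ((q\<^sup>2) ^ (D * (D + 1)) /
      (qpoch (x * q) (q\<^sup>2) (D + 1) * qpoch (q\<^sup>2 / (x * q)) (q\<^sup>2) (D + 1))))
      sums odd_rank_gf x q"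
    unfolding odd_rank_gf_def using \<open>x \<noteq> 0\<close> assms
    by (intro sums_mult mock_g_sums norm_power_less_one theta_prod_unit_nonzero) auto
  moreover have "q\<^sup>2 / (x * q) = q / x"
    using assms(2) by (simp add: power2_eq_square)
  moreover have "q * (q\<^sup>2) ^ (D * (D + 1)) = q ^ (2 * D\<^sup>2 + 2 * D + 1)" for D
  proof -
    have "2 * D\<^sup>2 + 2 * D + 1 = Suc (2 * (D * (D + 1)))"
      by (simp add: power2_eq_square)
    then show ?thesis
      by (simp only: power_mult power_Suc)
  qed
  ultimately show ?thesis
    by (simp only: times_divide_eq_right fixed_Durfee_gf_def[abs_def])
qed

lemma summable_all_symbols:
  assumes "norm q < 1" "q \<noteq> 0"
  shows "(\<lambda>S. norm q ^ symbol_size S) summable_on all_symbols"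
  unfolding all_symbols_def
proof (rule summable_on_SigmaI)
  define p where "p = complex_of_real (norm q)"
  have p: "norm p < 1" "p \<noteq> 0"
    using assms by (simp_all add: p_def)
  show gf: "((\<lambda>y. norm q ^ symbol_size (D, y)) has_sum Re (fixed_Durfee_gf 1 p D))
      (odd_lists (D + 1) \<times> odd_lists (D + 1))" for D
    using has_sum_Re[OF has_sum_fixed_Durfee_gf[OF p(1), of 1 D]]
    by (simp add: p_def flip: of_real_power)
  have "Re (fixed_Durfee_gf 1 p D) \<ge> 0" for D
    by (rule has_sum_nonneg[OF gf]) simp
  moreover have "summable (\<lambda>D. Re (fixed_Durfee_gf 1 p D))"
    using sums_Re[OF fixed_Durfee_gf_sums[OF p, of 1]] by (simp add: sums_iff)
  ultimately show "(\<lambda>D. Re (fixed_Durfee_gf 1 p D)) summable_on UNIV"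
    by (simp add: summable_on_UNIV_nonneg_real_iff)
qed simp

lemma odd_rank_gf_has_sum:
  assumes "norm q < 1" "q \<noteq> 0" "norm x = 1"
  shows "((\<lambda>S. x powi odd_rank S * q ^ symbol_size S) has_sum odd_rank_gf x q) all_symbols"
proof -
  have "(\<lambda>S. norm (x powi odd_rank S * q ^ symbol_size S)) summable_on all_symbols"
    using summable_all_symbols[OF assms(1,2)] assms(3)
    by (simp add: norm_mult norm_power norm_power_int)
  then have "(\<lambda>S. x powi odd_rank S * q ^ symbol_size S) summable_on all_symbols"
    by (rule abs_summable_summable)
  then obtain T where T: "((\<lambda>S. x powi odd_rank S * q ^ symbol_size S) has_sum T) all_symbols"
    by (auto simp: summable_on_def)
  from has_sum_SigmaD[OF this[unfolded all_symbols_def] has_sum_fixed_Durfee_gf[OF assms(1,3)]]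
  have "fixed_Durfee_gf x q sums T"
    by (rule has_sum_imp_sums)
  then have "odd_rank_gf x q = T"
    using fixed_Durfee_gf_sums[OF assms] sums_unique2 by blast
  with T show ?thesis
    by simp
qed

lemma odd_rank_gf_inverse:
  assumes "norm q < 1" "q \<noteq> 0" "norm x = 1" "x * y = 1"
  shows "odd_rank_gf y q = odd_rank_gf x q"
proof -
  have "x \<noteq> 0"
    using assms(3) by auto
  then have "y * q = q\<^sup>2 / (x * q)"
    using assms(2,4) by (simp add: power2_eq_square field_simps)
  with \<open>x \<noteq> 0\<close> show ?thesis
    unfolding odd_rank_gf_def
    using mock_g_reflect[of "q\<^sup>2" "x * q"] theta_prod_unit_nonzero[OF assms(1-3)] assms
    by (simp add: norm_power_less_one)
qed

lemma sums_N0: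
  fixes q :: complex
  assumes "((\<lambda>S. of_bool [odd_rank S = a] (mod M) * q ^ symbol_size S) has_sum T) all_symbols"
  shows "(\<lambda>n. of_nat (N0 a M n) * q ^ n) sums T"
proof (rule has_sum_imp_sums, rule has_sum_SigmaD)
  let ?f = "\<lambda>(n :: nat, S). of_bool [odd_rank S = a] (mod M) * q ^ symbol_size S"
  have "bij_betw (\<lambda>S. (symbol_size S, S)) all_symbols (Sigma UNIV odd_Durfee_symbols)"
    by (auto simp: bij_betw_def inj_on_def odd_Durfee_symbols_eq)
  from has_sum_reindex_bij_betw[OF this, of ?f] assms
  show "(?f has_sum T) (Sigma UNIV odd_Durfee_symbols)"
    by simp
  fix n
  have "(\<Sum>S\<in>odd_Durfee_symbols n. ?f (n, S)) =
      (\<Sum>S\<in>odd_Durfee_symbols n. of_bool [odd_rank S = a] (mod M) * q ^ n)"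
    by (intro sum.cong) (auto simp: odd_Durfee_symbols_eq)
  also have "\<dots> = of_nat (N0 a M n) * q ^ n"
    using finite_odd_Durfee_symbols[of n]
    by (simp add: N0_def sum_distrib_right[symmetric] Int_def)
  finally show "((\<lambda>S. ?f (n, S)) has_sum (of_nat (N0 a M n) * q ^ n)) (odd_Durfee_symbols n)"
    using has_sum_finite[OF finite_odd_Durfee_symbols, of "\<lambda>S. ?f (n, S)" n] by simp
qed

lemma sum_root_of_unity_powi:
  fixes k :: int
  assumes "M > 0"
  defines "z \<equiv> cis (2 * pi / real M)"
  shows "(\<Sum>j<M. (z ^ j) powi k) = of_nat M * of_bool (int M dvd k)"
proof -
  have powi_power: "(z ^ j) powi k = (z powi k) ^ j" for j
    by (simp add: power_int_power power_int_power' mult.commute)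
  show ?thesis
  proof (cases "int M dvd k")
    case True
    then obtain m where "k = int M * m" ..
    then have "z powi k = 1"
      using \<open>M > 0\<close> cis_multiple_2pi[of "of_int m"] by (simp add: z_def cis_power_int mult_ac)
    with True show ?thesis
      by (simp add: powi_power)
  next
    case False
    have "z powi k \<noteq> 1"
    proof
      assume "z powi k = 1"
      then obtain m :: int where "of_int k * (2 * pi / real M) = of_int m * 2 * pi"
        by (auto simp: z_def cis_power_int complex_eq_iff cos_one_2pi_int)
      then have "real_of_int k = real_of_int (m * int M)"
        using \<open>M > 0\<close> by (simp add: field_simps)
      then show False
        using False by (simp only: of_int_eq_iff) simp
    qed
    moreover have "(z powi k) ^ M = 1"
      unfolding powi_power[symmetric] using \<open>M > 0\<close> by (simp add: z_def Complex.DeMoivre)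
    ultimately show ?thesis
      using False one_diff_power_eq[of "z powi k" M] by (simp add: powi_power)
  qed
qed

lemma N0_sums_roots_of_unity:
  assumes "norm q < 1" "q \<noteq> 0" and "M > 0" and ab: "[int b = - a] (mod int M)"
  defines "z \<equiv> cis (2 * pi / real M)"
  shows "(\<lambda>n. of_nat (N0 a (int M) n) * q ^ n) sums
    ((\<Sum>j<M. (z ^ j) ^ b * odd_rank_gf (z ^ j) q) / of_nat M)"
proof (rule sums_N0)
  have "(\<Sum>j<M. (z ^ j) ^ b * ((z ^ j) powi odd_rank S * q ^ symbol_size S)) / of_nat M =
      of_bool [odd_rank S = a] (mod int M) * q ^ symbol_size S" for S
  proof -
    have "(\<Sum>j<M. (z ^ j) ^ b * ((z ^ j) powi odd_rank S * q ^ symbol_size S)) =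
        (\<Sum>j<M. (z ^ j) powi (odd_rank S + int b)) * q ^ symbol_size S"
      by (simp add: sum_distrib_left power_int_add z_def mult_ac)
    also have "\<dots> = of_nat M * of_bool (int M dvd odd_rank S + int b) * q ^ symbol_size S"
      unfolding z_def by (simp add: sum_root_of_unity_powi[OF \<open>M > 0\<close>])
    also have "int M dvd odd_rank S + int b \<longleftrightarrow> [odd_rank S = a] (mod int M)"
      using ab dvd_add_left_iff[of "int M" "int b + a" "odd_rank S - a"]
      by (simp add: cong_iff_dvd_diff algebra_simps)
    finally show ?thesis
      using \<open>M > 0\<close> by simp
  qed
  moreover have "((\<lambda>S. (\<Sum>j<M.
        (z ^ j) ^ b * ((z ^ j) powi odd_rank S * q ^ symbol_size S)) / of_nat M)
      has_sum ((\<Sum>j<M. (z ^ j) ^ b * odd_rank_gf (z ^ j) q) / of_nat M)) all_symbols"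
    by (intro has_sum_divide_const has_sum_sum has_sum_cmult_right odd_rank_gf_has_sum assms)
       (simp add: norm_power z_def)
  ultimately show "((\<lambda>S. of_bool [odd_rank S = a] (mod int M) * q ^ symbol_size S) has_sum
      ((\<Sum>j<M. (z ^ j) ^ b * odd_rank_gf (z ^ j) q) / of_nat M)) all_symbols"
    by (simp only:)
qed

section \<open>The odd rank at eighth roots of unity\<close>

definition zeta8 :: complex where
  "zeta8 = cis (pi / 4)"

lemma zeta8_powers:
  "zeta8\<^sup>2 = \<i>" "zeta8 ^ 3 = \<i> * zeta8" "zeta8 ^ 4 = - 1" "zeta8 ^ 5 = - zeta8"
  "zeta8 ^ 6 = - \<i>" "zeta8 ^ 7 = - (\<i> * zeta8)"
proof -
  show square: "zeta8\<^sup>2 = \<i>"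
    by (simp add: zeta8_def power2_eq_square cis_mult)
  have "zeta8 ^ 3 = zeta8\<^sup>2 * zeta8" "zeta8 ^ 4 = zeta8\<^sup>2 * zeta8\<^sup>2"
    "zeta8 ^ 5 = zeta8\<^sup>2 * zeta8\<^sup>2 * zeta8"
    "zeta8 ^ 6 = zeta8\<^sup>2 * zeta8\<^sup>2 * zeta8\<^sup>2" "zeta8 ^ 7 = zeta8\<^sup>2 * zeta8\<^sup>2 * zeta8\<^sup>2 * zeta8"
    by (simp_all add: eval_nat_numeral)
  then show "zeta8 ^ 3 = \<i> * zeta8" "zeta8 ^ 4 = - 1" "zeta8 ^ 5 = - zeta8"
    "zeta8 ^ 6 = - \<i>" "zeta8 ^ 7 = - (\<i> * zeta8)"
    by (simp_all add: square)
qed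

lemma norm_zeta8: "norm zeta8 = 1" and zeta8_nonzero: "zeta8 \<noteq> 0"
  by (simp_all add: zeta8_def)

lemma odd_rank_gf_zeta8:
  assumes "norm q < 1" "q \<noteq> 0"
  shows "odd_rank_gf (- \<i>) q = odd_rank_gf \<i> q"
    "odd_rank_gf (\<i> * zeta8) q = odd_rank_gf (- zeta8) q"
    "odd_rank_gf (- (\<i> * zeta8)) q = odd_rank_gf zeta8 q"
  using zeta8_powers(1)
  by (intro odd_rank_gf_inverse assms; simp add: norm_zeta8 power2_eq_square algebra_simps)+

lemma mock_bisection_const_square:
  "mock_bisection_const (q\<^sup>2) = 2 * qJ 4 q ^ 4 / ((qJ 2 q)\<^sup>2 * qJ 8 q)"
  by (simp add: mock_bisection_const_def qJ_power)

lemma odd_rank_gf_bisection_sum: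
  assumes q: "norm q < 1" "q \<noteq> 0" and x: "norm x = 1"
  shows "odd_rank_gf x q + odd_rank_gf (- x) q + 2 / q * odd_rank_gf (- (x\<^sup>2)) (q ^ 4) =
    q * mock_bisection_const (q\<^sup>2) /
      (theta_prod (x\<^sup>2 * q\<^sup>2) ((q\<^sup>2)\<^sup>2) * theta_prod (- (x\<^sup>2) * q ^ 4) ((q ^ 4)\<^sup>2))"
proof -
  have q2: "norm (q\<^sup>2) < 1" "q\<^sup>2 \<noteq> 0" and q4: "norm (q ^ 4) < 1" "q ^ 4 \<noteq> 0"
    using q by (simp_all add: norm_power_less_one)
  have args: "(x * q)\<^sup>2 = x\<^sup>2 * q\<^sup>2" "- (q\<^sup>2) * (x\<^sup>2 * q\<^sup>2) = - (x\<^sup>2) * q ^ 4"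
    "(q\<^sup>2) ^ 4 = (q ^ 4)\<^sup>2"
    by (simp_all add: power_mult_distrib flip: power_mult power_add)
  have "x * q \<noteq> 0"
    using x q by auto
  have nz: "theta_prod (x\<^sup>2 * q\<^sup>2) ((q\<^sup>2)\<^sup>2) \<noteq> 0" "theta_prod (- (x\<^sup>2) * q ^ 4) ((q ^ 4)\<^sup>2) \<noteq> 0"
    by (rule theta_prod_unit_nonzero; use q2 q4 x in \<open>simp add: norm_power\<close>)+
  have "mock_g (x * q) (q\<^sup>2) + mock_g (- (x * q)) (q\<^sup>2)
      + 2 * q\<^sup>2 * mock_g (- (x\<^sup>2) * q ^ 4) ((q ^ 4)\<^sup>2) = mock_bisection_const (q\<^sup>2) /
      (theta_prod (x\<^sup>2 * q\<^sup>2) ((q\<^sup>2)\<^sup>2) * theta_prod (- (x\<^sup>2) * q ^ 4) ((q ^ 4)\<^sup>2))" (is "?l = ?r")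
    using mock_g_bisection_sum[OF q2 \<open>x * q \<noteq> 0\<close>] nz unfolding args by simp
  then have "q * ?l = q * ?r"
    by simp
  moreover have "2 / q * odd_rank_gf (- (x\<^sup>2)) (q ^ 4) =
      q * (2 * q\<^sup>2 * mock_g (- (x\<^sup>2) * q ^ 4) ((q ^ 4)\<^sup>2))"
    using q(2) by (simp add: odd_rank_gf_def eval_nat_numeral)
  ultimately show ?thesis
    by (simp add: odd_rank_gf_def algebra_simps)
qed

lemma odd_rank_gf_bisection_diff:
  assumes q: "norm q < 1" "q \<noteq> 0" and x: "norm x = 1" "x\<^sup>2 \<noteq> - 1"
  shows "odd_rank_gf x q - odd_rank_gf (- x) q = - 2 / x + 2 / x ^ 3 * mock_g (- 1 / x\<^sup>2) (q ^ 8)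
    + mock_bisection_const (q\<^sup>2) /
      (x * (theta_prod (x\<^sup>2 * q\<^sup>2) ((q\<^sup>2)\<^sup>2) * theta_prod (- 1 / x\<^sup>2) (q ^ 8)))"
proof -
  have q2: "norm (q\<^sup>2) < 1" "q\<^sup>2 \<noteq> 0" and q8: "norm (q ^ 8) < 1"
    using q by (simp_all add: norm_power_less_one)
  have "x \<noteq> 0" "x * q \<noteq> 0"
    using x q by auto
  have args: "(x * q)\<^sup>2 = x\<^sup>2 * q\<^sup>2" "- (q\<^sup>2) / (x\<^sup>2 * q\<^sup>2) = - 1 / x\<^sup>2" "(q\<^sup>2) ^ 4 = q ^ 8"
    using q by (simp_all add: power_mult_distrib flip: power_mult power_add)
  have "- 1 / x\<^sup>2 \<noteq> 1"
    using \<open>x \<noteq> 0\<close> x(2) by (simp add: field_simps eq_commute[of "- 1"])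
  then have theta_nz: "theta_prod (- 1 / x\<^sup>2) (q ^ 8) \<noteq> 0"
    using q8 x(1) by (intro theta_prod_nonzero) (simp_all add: norm_divide norm_power)
  have theta_sq_nz: "theta_prod (x\<^sup>2 * q\<^sup>2) ((q\<^sup>2)\<^sup>2) \<noteq> 0"
    by (rule theta_prod_unit_nonzero; use q2 x in \<open>simp add: norm_power\<close>)
  define M N T where "M = mock_g (- 1 / x\<^sup>2) (q ^ 8)" and "N = mock_bisection_const (q\<^sup>2)"
    and "T = theta_prod (x\<^sup>2 * q\<^sup>2) ((q\<^sup>2)\<^sup>2) * theta_prod (- 1 / x\<^sup>2) (q ^ 8)"
  have "odd_rank_gf x q - odd_rank_gf (- x) q =
      q * (mock_g (x * q) (q\<^sup>2) - mock_g (- (x * q)) (q\<^sup>2))"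
    by (simp add: odd_rank_gf_def algebra_simps)
  also have "mock_g (x * q) (q\<^sup>2) - mock_g (- (x * q)) (q\<^sup>2) =
      - 2 / (x * q) + 2 * q\<^sup>2 / (x * q) ^ 3 * M + N / (x * q * T)"
    using mock_g_bisection_diff[OF q2 \<open>x * q \<noteq> 0\<close>] theta_nz theta_sq_nz unfolding args M_def N_def T_def
      by simp
  also have "q * (- 2 / (x * q) + 2 * q\<^sup>2 / (x * q) ^ 3 * M + N / (x * q * T)) =
      - 2 / x + 2 / x ^ 3 * M + N / (x * T)"
    using q(2) \<open>x \<noteq> 0\<close>
    by (simp add: ring_distribs power_mult_distrib power2_eq_square power3_eq_cube)
  finally show ?thesis
    by (simp add: M_def N_def T_def)
qed

lemma odd_rank_gf_sum_1:
  assumes q: "norm q < 1" "q \<noteq> 0"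
  shows "odd_rank_gf 1 q + odd_rank_gf (- 1) q =
    - 2 / q * odd_rank_gf (- 1) (q ^ 4)
    + 2 * q * (qJ 4 q ^ 8 * (qJ 16 q)\<^sup>2 / (qJ 2 q ^ 4 * qJ 8 q ^ 5))"
proof -
  have q2: "norm (q\<^sup>2) < 1" "q\<^sup>2 \<noteq> 0" and q4: "norm (q ^ 4) < 1" "q ^ 4 \<noteq> 0"
    using q by (simp_all add: norm_power_less_one)
  have "odd_rank_gf 1 q + odd_rank_gf (- 1) q + 2 / q * odd_rank_gf (- 1) (q ^ 4) =
    q * mock_bisection_const (q\<^sup>2) /
      ((qJ 2 q / qJ 4 q)\<^sup>2 * ((qJ 8 q)\<^sup>2 / (qJ 4 q * qJ 16 q))\<^sup>2)"
    using odd_rank_gf_bisection_sum[OF q, of 1] theta_prod_odd[OF q2] theta_prod_minus_odd[OF q4]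
    by (simp add: qJ_power)
  also have "\<dots> = 2 * q * (qJ 4 q ^ 8 * (qJ 16 q)\<^sup>2 / (qJ 2 q ^ 4 * qJ 8 q ^ 5))"
    unfolding mock_bisection_const_square using qJ_nonzero[OF q(1)]
    by (simp add: field_simps eval_nat_numeral)
  finally show ?thesis
    by (simp add: algebra_simps)
qed

lemma odd_rank_gf_ii:
  assumes q: "norm q < 1" "q \<noteq> 0"
  shows "odd_rank_gf \<i> q = - 1 / q * odd_rank_gf 1 (q ^ 4) + q * (qJ 8 q ^ 3 / (qJ 4 q)\<^sup>2)"
proof -
  have q2: "norm (q\<^sup>2) < 1" "q\<^sup>2 \<noteq> 0" and q4: "norm (q ^ 4) < 1" "q ^ 4 \<noteq> 0"
    using q by (simp_all add: norm_power_less_one)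
  have "2 * (odd_rank_gf \<i> q + 1 / q * odd_rank_gf 1 (q ^ 4)) =
    q * mock_bisection_const (q\<^sup>2) /
      (((qJ 4 q)\<^sup>2 / (qJ 2 q * qJ 8 q))\<^sup>2 * (qJ 4 q / qJ 8 q)\<^sup>2)"
    using odd_rank_gf_bisection_sum[OF q, of \<i>] theta_prod_minus_odd[OF q2] theta_prod_odd[OF q4]
    by (simp add: qJ_power odd_rank_gf_zeta8[OF q] ring_distribs)
  also have "\<dots> = 2 * (q * (qJ 8 q ^ 3 / (qJ 4 q)\<^sup>2))"
    unfolding mock_bisection_const_square using qJ_nonzero[OF q(1)]
    by (simp add: field_simps eval_nat_numeral)
  finally have "odd_rank_gf \<i> q + 1 / q * odd_rank_gf 1 (q ^ 4) = q * (qJ 8 q ^ 3 / (qJ 4 q)\<^sup>2)"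
    by (simp only: mult_cancel_left) simp
  then show ?thesis
    by (simp add: algebra_simps)
qed

lemma odd_rank_gf_sum_1_ii:
  assumes q: "norm q < 1" "q \<noteq> 0"
  shows "odd_rank_gf 1 q + odd_rank_gf (- 1) q + 2 * odd_rank_gf \<i> q =
    4 / q ^ 5 * odd_rank_gf (- 1) (q ^ 16)
    - 4 * q ^ 3 * (qJ 16 q ^ 8 * (qJ 64 q)\<^sup>2 / (qJ 8 q ^ 4 * qJ 32 q ^ 5))
    + 2 * q * (qJ 4 q ^ 8 * (qJ 16 q)\<^sup>2 / (qJ 2 q ^ 4 * qJ 8 q ^ 5))
    + 2 * q * (qJ 8 q ^ 3 / (qJ 4 q)\<^sup>2)"
proof -
  have q4: "norm (q ^ 4) < 1" "q ^ 4 \<noteq> 0"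
    using q by (simp_all add: norm_power_less_one)
  define X where "X = qJ 16 q ^ 8 * (qJ 64 q)\<^sup>2 / (qJ 8 q ^ 4 * qJ 32 q ^ 5)"
  have "odd_rank_gf 1 q + odd_rank_gf (- 1) q + 2 * odd_rank_gf \<i> q =
      - 2 / q * (odd_rank_gf 1 (q ^ 4) + odd_rank_gf (- 1) (q ^ 4))
      + 2 * q * (qJ 4 q ^ 8 * (qJ 16 q)\<^sup>2 / (qJ 2 q ^ 4 * qJ 8 q ^ 5))
      + 2 * q * (qJ 8 q ^ 3 / (qJ 4 q)\<^sup>2)"
    unfolding odd_rank_gf_sum_1[OF q] odd_rank_gf_ii[OF q]
    by (simp add: ring_distribs diff_divide_distrib)
  also have "odd_rank_gf 1 (q ^ 4) + odd_rank_gf (- 1) (q ^ 4) =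
      - 2 / q ^ 4 * odd_rank_gf (- 1) (q ^ 16) + 2 * q ^ 4 * X"
    using odd_rank_gf_sum_1[OF q4] by (simp add: X_def qJ_power_simps flip: power_mult)
  also have "- 2 / q * (- 2 / q ^ 4 * odd_rank_gf (- 1) (q ^ 16) + 2 * q ^ 4 * X) =
      4 / q ^ 5 * odd_rank_gf (- 1) (q ^ 16) - 4 * q ^ 3 * X"
    using q(2) by (simp add: field_simps eval_nat_numeral)
  finally show ?thesis
    by (simp add: X_def)
qed

lemma odd_rank_gf_sum_zeta8:
  assumes q: "norm q < 1" "q \<noteq> 0"
  shows "odd_rank_gf zeta8 q + odd_rank_gf (- zeta8) q =
    2 / q ^ 5 * odd_rank_gf 1 (q ^ 16) - 2 * q ^ 3 * (qJ 32 q ^ 3 / (qJ 16 q)\<^sup>2)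
    + 2 * q * (qJ 4 q ^ 5 * qJ 32 q / ((qJ 2 q)\<^sup>2 * (qJ 8 q)\<^sup>2 * qJ 16 q))"
proof -
  have q2: "norm (q\<^sup>2) < 1" "q\<^sup>2 \<noteq> 0" and q4: "norm (q ^ 4) < 1" "q ^ 4 \<noteq> 0"
    using q by (simp_all add: norm_power_less_one)
  have "odd_rank_gf zeta8 q + odd_rank_gf (- zeta8) q + 2 / q * odd_rank_gf \<i> (q ^ 4) =
    q * mock_bisection_const (q\<^sup>2) /
      ((qJ 8 q)\<^sup>2 / (qJ 4 q * qJ 16 q) * ((qJ 16 q)\<^sup>2 / (qJ 8 q * qJ 32 q)))"
    using odd_rank_gf_bisection_sum[OF q norm_zeta8] theta_prod_ii_odd(1)[OF q2]
      theta_prod_ii_odd(2)[OF q4]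
    by (simp add: qJ_power zeta8_powers odd_rank_gf_zeta8[OF q4])
  also have "\<dots> = 2 * q * (qJ 4 q ^ 5 * qJ 32 q / ((qJ 2 q)\<^sup>2 * (qJ 8 q)\<^sup>2 * qJ 16 q))"
    unfolding mock_bisection_const_square using qJ_nonzero[OF q(1)]
    by (simp add: field_simps eval_nat_numeral)
  finally have "odd_rank_gf zeta8 q + odd_rank_gf (- zeta8) q = - 2 / q * odd_rank_gf \<i> (q ^ 4) +
      2 * q * (qJ 4 q ^ 5 * qJ 32 q / ((qJ 2 q)\<^sup>2 * (qJ 8 q)\<^sup>2 * qJ 16 q))"
    by (simp add: algebra_simps)
  moreover have "odd_rank_gf \<i> (q ^ 4) =
      - 1 / q ^ 4 * odd_rank_gf 1 (q ^ 16) + q ^ 4 * (qJ 32 q ^ 3 / (qJ 16 q)\<^sup>2)"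
    using odd_rank_gf_ii[OF q4] by (simp add: qJ_power flip: power_mult)
  moreover have "- 2 / q * (- 1 / q ^ 4 * X + q ^ 4 * Y) = 2 / q ^ 5 * X - 2 * q ^ 3 * Y" for X Y
    using q(2) by (simp add: field_simps eval_nat_numeral)
  ultimately show ?thesis
    by (simp only:)
qed

lemma odd_rank_gf_diff_1:
  assumes q: "norm q < 1" "q \<noteq> 0"
  shows "odd_rank_gf 1 q - odd_rank_gf (- 1) q =
    - 2 + 2 * mock_g (- 1) (q ^ 8) + qJ 4 q ^ 6 * qJ 8 q / (qJ 2 q ^ 4 * (qJ 16 q)\<^sup>2)"
proof -
  have q2: "norm (q\<^sup>2) < 1" "q\<^sup>2 \<noteq> 0" and q8: "norm (q ^ 8) < 1"
    using q by (simp_all add: norm_power_less_one)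
  have "odd_rank_gf 1 q - odd_rank_gf (- 1) q = - 2 + 2 * mock_g (- 1) (q ^ 8) +
    mock_bisection_const (q\<^sup>2) / ((qJ 2 q / qJ 4 q)\<^sup>2 * (2 * (qJ 16 q / qJ 8 q)\<^sup>2))"
    using odd_rank_gf_bisection_diff[OF q, of 1] theta_prod_odd[OF q2] theta_prod_minus_one[OF q8]
    by (simp add: qJ_power)
  also have "mock_bisection_const (q\<^sup>2) / ((qJ 2 q / qJ 4 q)\<^sup>2 * (2 * (qJ 16 q / qJ 8 q)\<^sup>2)) =
      qJ 4 q ^ 6 * qJ 8 q / (qJ 2 q ^ 4 * (qJ 16 q)\<^sup>2)"
    unfolding mock_bisection_const_square using qJ_nonzero[OF q(1)]
    by (simp add: field_simps eval_nat_numeral)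
  finally show ?thesis .
qed

lemma mock_g_ii:
  assumes q: "norm q < 1" "q \<noteq> 0"
  shows "(1 + \<i>) * mock_g \<i> q = \<i> - 1 - 2 * q * mock_g q (q ^ 4)
    + qJ 2 q ^ 7 / (qJ 1 q ^ 3 * qJ 4 q ^ 3)"
proof -
  have q2: "norm (q\<^sup>2) < 1"
    using q by (simp add: norm_power_less_one)
  have nz: "theta_prod (- 1) (q\<^sup>2) \<noteq> 0" "theta_prod q (q ^ 4) \<noteq> 0"
      "theta_prod \<i> q \<noteq> 0" "theta_prod (- \<i>) q \<noteq> 0"
    using theta_prod_minus_one[OF q2] theta_prod_power4(1)[OF q] qJ_nonzero[OF q(1)]
      theta_prod_mult_minus[OF q(1), of \<i>]
    by (auto simp: qJ_power)
  have "mock_g (q * \<i>) q = - \<i> + 1 + \<i> * mock_g \<i> q"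
    using mock_g_shift[OF q _ nz(3)] by (simp add: power3_eq_cube)
  moreover have "q / (- \<i>) = q * \<i>"
    by (simp add: field_simps)
  ultimately have minus: "mock_g (- \<i>) q = - \<i> + 1 + \<i> * mock_g \<i> q"
    using mock_g_reflect[OF q _ nz(4)] by (simp add: mult.commute)
  have "mock_g \<i> q + mock_g (- \<i>) q + 2 * q * mock_g q (q ^ 4) =
      mock_bisection_const q / (2 * (qJ 4 q / qJ 2 q)\<^sup>2 * (qJ 1 q / qJ 2 q))"
    using mock_g_bisection_sum[OF q, of \<i>] nz
    by (simp add: theta_prod_minus_one[OF q2] theta_prod_power4(1)[OF q] qJ_power)
  also have "\<dots> = qJ 2 q ^ 7 / (qJ 1 q ^ 3 * qJ 4 q ^ 3)"
    unfolding mock_bisection_const_def using qJ_nonzero[OF q(1)]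
    by (simp add: field_simps eval_nat_numeral)
  finally show ?thesis
    unfolding minus by (simp add: algebra_simps)
qed

lemma odd_rank_gf_diff_zeta8:
  assumes q: "norm q < 1" "q \<noteq> 0"
  shows "(1 - \<i>) * zeta8 * (odd_rank_gf zeta8 q - odd_rank_gf (- zeta8) q) =
    4 * q ^ 8 * mock_g (q ^ 8) (q ^ 32) - 2 * (qJ 16 q ^ 7 / (qJ 8 q ^ 3 * qJ 32 q ^ 3))
    + 2 * (qJ 4 q ^ 5 * (qJ 16 q)\<^sup>2 / ((qJ 2 q)\<^sup>2 * qJ 8 q ^ 3 * qJ 32 q))"
proof -
  have q2: "norm (q\<^sup>2) < 1" "q\<^sup>2 \<noteq> 0" and q8: "norm (q ^ 8) < 1" "q ^ 8 \<noteq> 0"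
    using q by (simp_all add: norm_power_less_one)
  define M where "M = mock_g \<i> (q ^ 8)"
  define N where "N = mock_bisection_const (q\<^sup>2) /
    ((qJ 8 q)\<^sup>2 / (qJ 4 q * qJ 16 q) * (qJ 32 q / qJ 16 q))"
  have ii_simps: "- 1 / \<i> = \<i>" "\<i> \<noteq> - 1" "1 - \<i> \<noteq> 0"
    by (simp_all add: complex_eq_iff field_simps)
  have "odd_rank_gf zeta8 q - odd_rank_gf (- zeta8) q = - 2 / zeta8 + 2 / (\<i> * zeta8) * M
      + N / (zeta8 * (1 - \<i>))"
    using odd_rank_gf_bisection_diff[OF q norm_zeta8] theta_prod_ii_odd(1)[OF q2]
      theta_prod_ii[OF q8(1)] ii_simps(1,2)
    by (simp add: qJ_power zeta8_powers M_def N_def mult_ac)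
  then have "(1 - \<i>) * zeta8 * (odd_rank_gf zeta8 q - odd_rank_gf (- zeta8) q) =
      (1 - \<i>) * zeta8 * (- 2 / zeta8 + 2 / (\<i> * zeta8) * M + N / (zeta8 * (1 - \<i>)))"
    by simp
  also have "\<dots> = - 2 * (1 - \<i>) - 2 * ((1 + \<i>) * M) + N"
    using zeta8_nonzero ii_simps(3) by (simp add: field_simps)
  also have "(1 + \<i>) * M = \<i> - 1 - 2 * q ^ 8 * mock_g (q ^ 8) (q ^ 32)
      + qJ 16 q ^ 7 / (qJ 8 q ^ 3 * qJ 32 q ^ 3)"
    using mock_g_ii[OF q8] by (simp add: M_def qJ_power flip: power_mult)
  also have "N = 2 * (qJ 4 q ^ 5 * (qJ 16 q)\<^sup>2 / ((qJ 2 q)\<^sup>2 * qJ 8 q ^ 3 * qJ 32 q))"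
    unfolding N_def mock_bisection_const_square using qJ_nonzero[OF q(1)]
    by (simp add: field_simps eval_nat_numeral)
  finally show ?thesis
    by (simp add: algebra_simps)
qed

section \<open>Generating functions in residue classes\<close>

definition has_gf :: "(nat \<Rightarrow> complex) \<Rightarrow> (complex \<Rightarrow> complex) \<Rightarrow> bool" where
  "has_gf c F \<longleftrightarrow> (\<forall>q. norm q < 1 \<longrightarrow> q \<noteq> 0 \<longrightarrow> (\<lambda>n. c n * q ^ n) sums F q)"

lemma has_gfD:
  assumes "has_gf c F" "norm q < 1" "q \<noteq> 0"
  shows "(\<lambda>n. c n * q ^ n) sums F q"
  using assms by (simp add: has_gf_def)

lemma sums_even_odd_parts:
  fixes f :: "nat \<Rightarrow> complex"
  assumes "f sums s" "(\<lambda>n. (- 1) ^ n * f n) sums t"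
  shows "(\<lambda>n. f (2 * n)) sums ((s + t) / 2)" and "(\<lambda>n. f (2 * n + 1)) sums ((s - t) / 2)"
proof -
  have "(f n + (- 1) ^ n * f n) / 2 = 0" if "n \<notin> range (\<lambda>n. 2 * n)" for n
    using that by (cases "even n") (auto elim!: evenE)
  moreover have "(\<lambda>n. (f n + (- 1) ^ n * f n) / 2) sums ((s + t) / 2)"
    by (intro sums_divide sums_add assms)
  ultimately have "(\<lambda>n. (f (2 * n) + (- 1) ^ (2 * n) * f (2 * n)) / 2) sums ((s + t) / 2)"
    by (subst sums_mono_reindex[of "\<lambda>n. 2 * n" "\<lambda>n. (f n + (- 1) ^ n * f n) / 2"])
       (auto simp: strict_mono_def)
  then show "(\<lambda>n. f (2 * n)) sums ((s + t) / 2)"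
    by simp
  have "(f n - (- 1) ^ n * f n) / 2 = 0" if "n \<notin> range (\<lambda>n. 2 * n + 1)" for n
    using that by (cases "even n") (auto elim!: oddE)
  moreover have "(\<lambda>n. (f n - (- 1) ^ n * f n) / 2) sums ((s - t) / 2)"
    by (intro sums_divide sums_diff assms)
  ultimately have "(\<lambda>n. (f (2 * n + 1) - (- 1) ^ (2 * n + 1) * f (2 * n + 1)) / 2) sums
      ((s - t) / 2)"
    by (subst sums_mono_reindex[of "\<lambda>n. 2 * n + 1" "\<lambda>n. (f n - (- 1) ^ n * f n) / 2"])
       (auto simp: strict_mono_def)
  then show "(\<lambda>n. f (2 * n + 1)) sums ((s - t) / 2)"
    by simp
qed

lemma has_gf_bisect:
  assumes gf: "has_gf c F"
    and F: "\<And>q. norm q < 1 \<Longrightarrow> q \<noteq> 0 \<Longrightarrow> F q = A (q\<^sup>2) + q * B (q\<^sup>2)"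
    and parts: "\<And>n. a n = c (2 * n)" "\<And>n. b n = c (2 * n + 1)"
  shows "has_gf a A \<and> has_gf b B"
proof -
  have "(\<lambda>n. a n * w ^ n) sums A w \<and> (\<lambda>n. b n * w ^ n) sums B w" if w: "norm w < 1" "w \<noteq> 0" for w
  proof -
    define r where "r = csqrt w"
    have square: "r\<^sup>2 = w"
      by (simp add: r_def)
    have r: "norm r < 1" "r \<noteq> 0"
      using w by (auto simp: r_def real_sqrt_lt_1_iff)
    have plus: "(\<lambda>n. c n * r ^ n) sums (A w + r * B w)"
      using has_gfD[OF gf r] F[OF r] by (simp add: square)
    have minus: "(\<lambda>n. (- 1) ^ n * (c n * r ^ n)) sums (A w - r * B w)"
      using has_gfD[OF gf, of "- r"] F[of "- r"] r
      by (simp add: square power_minus[of r] mult_ac)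
    have "(\<lambda>n. a n * w ^ n) sums A w"
      using sums_even_odd_parts(1)[OF plus minus] by (simp add: parts power_mult square)
    moreover have "(\<lambda>n. b n * w ^ n) sums B w"
      using sums_mult[OF sums_even_odd_parts(2)[OF plus minus], of "1 / r"] r(2)
      by (simp add: parts power_mult square)
    ultimately show ?thesis ..
  qed
  then show ?thesis
    by (simp add: has_gf_def)
qed

lemma N0_8_has_gf_sum:
  assumes "[int b = - a] (mod 8)"
  shows "has_gf (\<lambda>n. of_nat (N0 a 8 n))
    (\<lambda>q. 1/8 * (\<Sum>j<8. (zeta8 ^ j) ^ b * odd_rank_gf (zeta8 ^ j) q))"
proof -
  have "zeta8 = cis (2 * pi / real 8)"
    by (simp add: zeta8_def)
  then show ?thesis
    using N0_sums_roots_of_unity[of _ 8 b a] assms by (simp add: has_gf_def)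
qed

lemma sum_lessThan_8:
  fixes f :: "nat \<Rightarrow> complex"
  shows "(\<Sum>j<8. f j) = f 0 + f 1 + f 2 + f 3 + f 4 + f 5 + f 6 + f 7"
  by (simp add: eval_nat_numeral)

lemma ii_powers: "\<i> ^ 3 = - \<i>" "\<i> ^ 4 = 1" "\<i> ^ 5 = \<i>" "\<i> ^ 6 = - 1" "\<i> ^ 7 = - \<i>"
  by (simp_all add: eval_nat_numeral)

lemma N0_8_has_gf_0_4:
  assumes "(a, e) \<in> {(0, 1), (4, - 1)}"
  shows "has_gf (\<lambda>n. of_nat (N0 a 8 n)) (\<lambda>q. 1/8 * (odd_rank_gf 1 q + odd_rank_gf (- 1) q
    + 2 * odd_rank_gf \<i> q + e * (2 * (odd_rank_gf zeta8 q + odd_rank_gf (- zeta8) q))))"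
  using assms N0_8_has_gf_sum[of 0 0] N0_8_has_gf_sum[of 4 4]
  by (auto simp: has_gf_def cong_def sum_lessThan_8 zeta8_powers odd_rank_gf_zeta8 algebra_simps)

lemma N0_8_has_gf_1_3:
  assumes "(a, e) \<in> {(1, 1), (3, - 1)}"
  shows "has_gf (\<lambda>n. of_nat (N0 a 8 n)) (\<lambda>q. 1/8 * (odd_rank_gf 1 q - odd_rank_gf (- 1) q
    + e * ((1 - \<i>) * zeta8 * (odd_rank_gf zeta8 q - odd_rank_gf (- zeta8) q))))"
  using assms N0_8_has_gf_sum[of 7 1] N0_8_has_gf_sum[of 5 3]
  by (auto simp: has_gf_def cong_def sum_lessThan_8 zeta8_powers ii_powers
      odd_rank_gf_zeta8 algebra_simps)

lemma N0_8_has_gf_2: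
  "has_gf (\<lambda>n. of_nat (N0 2 8 n))
    (\<lambda>q. 1/8 * (odd_rank_gf 1 q + odd_rank_gf (- 1) q - 2 * odd_rank_gf \<i> q))"
  using N0_8_has_gf_sum[of 6 2]
  by (simp add: has_gf_def cong_def sum_lessThan_8 zeta8_powers ii_powers
      odd_rank_gf_zeta8 algebra_simps)

section \<open>Two-dissections of theta quotients\<close>

lemma inverse_qJ_1_power2:
  assumes "norm q < 1" "q \<noteq> 0"
  shows "1 / (qJ 1 q)\<^sup>2 = qJ 8 q ^ 5 / (qJ 2 q ^ 5 * (qJ 16 q)\<^sup>2)
    + 2 * q * ((qJ 4 q)\<^sup>2 * (qJ 16 q)\<^sup>2 / (qJ 2 q ^ 5 * qJ 8 q))"
proof -
  have "1 / (qJ 1 q)\<^sup>2 = phi q * ((qJ 4 q)\<^sup>2 / qJ 2 q ^ 5)"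
    unfolding phi_def using qJ_nonzero[OF assms(1)] by simp
  also have "\<dots> = phi (q ^ 4) * ((qJ 4 q)\<^sup>2 / qJ 2 q ^ 5)
      + 2 * q * ((qJ 16 q)\<^sup>2 / qJ 8 q) * ((qJ 4 q)\<^sup>2 / qJ 2 q ^ 5)"
    unfolding phi_bisection[OF assms] by (rule distrib_right)
  also have "phi (q ^ 4) * ((qJ 4 q)\<^sup>2 / qJ 2 q ^ 5) = qJ 8 q ^ 5 / (qJ 2 q ^ 5 * (qJ 16 q)\<^sup>2)"
    unfolding phi_def using qJ_nonzero[OF assms(1)] by (simp add: qJ_power)
  finally show ?thesis
    by (simp add: mult_ac)
qed

lemma inverse_qJ_1_power4:
  assumes "norm q < 1" "q \<noteq> 0"
  shows "1 / qJ 1 q ^ 4 = qJ 4 q ^ 14 / (qJ 2 q ^ 14 * qJ 8 q ^ 4)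
    + 4 * q * ((qJ 4 q)\<^sup>2 * qJ 8 q ^ 4 / qJ 2 q ^ 10)"
proof -
  have "1 / qJ 1 q ^ 4 = (phi q)\<^sup>2 * (qJ 4 q ^ 4 / qJ 2 q ^ 10)"
    unfolding phi_def using qJ_nonzero[OF assms(1)]
    by (simp add: power_divide power_mult_distrib flip: power_mult)
  also have "\<dots> = (phi (q\<^sup>2))\<^sup>2 * (qJ 4 q ^ 4 / qJ 2 q ^ 10)
      + 4 * q * (qJ 8 q ^ 4 / (qJ 4 q)\<^sup>2 * (qJ 4 q ^ 4 / qJ 2 q ^ 10))"
    unfolding phi_square_bisection[OF assms] by (simp add: algebra_simps)
  also have "(phi (q\<^sup>2))\<^sup>2 * (qJ 4 q ^ 4 / qJ 2 q ^ 10) = qJ 4 q ^ 14 / (qJ 2 q ^ 14 * qJ 8 q ^ 4)"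
    unfolding phi_def using qJ_nonzero[OF assms(1)]
    by (simp add: qJ_power power_divide power_mult_distrib flip: power_mult)
  also have "qJ 8 q ^ 4 / (qJ 4 q)\<^sup>2 * (qJ 4 q ^ 4 / qJ 2 q ^ 10) =
      (qJ 4 q)\<^sup>2 * qJ 8 q ^ 4 / qJ 2 q ^ 10"
    using qJ_nonzero[OF assms(1)] by (simp add: field_simps eval_nat_numeral)
  finally show ?thesis .
qed

lemma divide_qJ_1_power2:
  assumes "norm q < 1" "q \<noteq> 0"
  defines "P \<equiv> qJ 8 q ^ 5 / (qJ 2 q ^ 5 * (qJ 16 q)\<^sup>2)
    + 2 * q * ((qJ 4 q)\<^sup>2 * (qJ 16 q)\<^sup>2 / (qJ 2 q ^ 5 * qJ 8 q))"
  shows "X / (qJ 1 q)\<^sup>2 = X * P" and "X / ((qJ 1 q)\<^sup>2 * Y) = X / Y * P"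
    and "X / ((qJ 1 q)\<^sup>2 * Y * Z) = X / (Y * Z) * P"
  unfolding P_def inverse_qJ_1_power2[OF assms(1,2), symmetric] by simp_all

lemma divide_qJ_1_power4:
  assumes "norm q < 1" "q \<noteq> 0"
  defines "P \<equiv> qJ 4 q ^ 14 / (qJ 2 q ^ 14 * qJ 8 q ^ 4)
    + 4 * q * ((qJ 4 q)\<^sup>2 * qJ 8 q ^ 4 / qJ 2 q ^ 10)"
  shows "X / qJ 1 q ^ 4 = X * P" and "X / (qJ 1 q ^ 4 * Y) = X / Y * P"
  unfolding P_def inverse_qJ_1_power4[OF assms(1,2), symmetric] by simp_all

lemma bisect_over_qJ_1_power2:
  assumes "norm q < 1" "q \<noteq> 0"
  shows "qJ 2 q ^ 3 / qJ 1 q ^ 2 = qJ 8 q ^ 5 / (qJ 2 q ^ 2 * qJ 16 q ^ 2)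
      + q * (2 * (qJ 4 q ^ 2 * qJ 16 q ^ 2 / (qJ 2 q ^ 2 * qJ 8 q)))"
    and "qJ 4 q ^ 6 / (qJ 1 q ^ 2 * qJ 2 q ^ 3) =
      qJ 4 q ^ 6 * qJ 8 q ^ 5 / (qJ 2 q ^ 8 * qJ 16 q ^ 2)
      + q * (2 * (qJ 4 q ^ 8 * qJ 16 q ^ 2 / (qJ 2 q ^ 8 * qJ 8 q)))"
    and "qJ 2 q ^ 5 * qJ 16 q / (qJ 1 q ^ 2 * qJ 4 q ^ 2 * qJ 8 q) =
      qJ 8 q ^ 4 / (qJ 16 q * qJ 4 q ^ 2)
      + q * (2 * (qJ 16 q ^ 3 / qJ 8 q ^ 2))"
    and "qJ 2 q ^ 5 * qJ 8 q ^ 2 / (qJ 1 q ^ 2 * qJ 4 q ^ 3 * qJ 16 q) =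
      qJ 8 q ^ 7 / (qJ 4 q ^ 3 * qJ 16 q ^ 3) + q * (2 * (qJ 8 q * qJ 16 q / qJ 4 q))"
  by (simp only: divide_qJ_1_power2[OF assms],
      simp add: field_simps qJ_nonzero[OF assms(1)]; algebra)+

lemma bisect_over_qJ_1_power4:
  assumes "norm q < 1" "q \<noteq> 0"
  shows "qJ 2 q ^ 8 * qJ 8 q ^ 2 / (qJ 1 q ^ 4 * qJ 4 q ^ 5) =
      qJ 4 q ^ 9 / (qJ 2 q ^ 6 * qJ 8 q ^ 2)
      + q * (4 * (qJ 8 q ^ 6 / (qJ 2 q ^ 2 * qJ 4 q ^ 3)))"
    and "qJ 2 q ^ 6 * qJ 4 q / (qJ 1 q ^ 4 * qJ 8 q ^ 2) = qJ 4 q ^ 15 / (qJ 2 q ^ 8 * qJ 8 q ^ 6)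
      + q * (4 * (qJ 4 q ^ 3 * qJ 8 q ^ 2 / qJ 2 q ^ 4))"
    and "qJ 2 q ^ 3 * qJ 4 q ^ 2 / qJ 1 q ^ 4 = qJ 4 q ^ 16 / (qJ 2 q ^ 11 * qJ 8 q ^ 4)
      + q * (4 * (qJ 4 q ^ 4 * qJ 8 q ^ 4 / qJ 2 q ^ 7))"
    and "qJ 2 q ^ 4 * qJ 16 q ^ 2 / (qJ 1 q ^ 4 * qJ 8 q) =
      qJ 4 q ^ 14 * qJ 16 q ^ 2 / (qJ 2 q ^ 10 * qJ 8 q ^ 5)
      + q * (4 * (qJ 4 q ^ 2 * qJ 8 q ^ 3 * qJ 16 q ^ 2 / qJ 2 q ^ 6))"
  by (simp only: divide_qJ_1_power4[OF assms],
      simp add: field_simps qJ_nonzero[OF assms(1)]; algebra)+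

lemma bisect_over_qJ_1_power6:
  assumes "norm q < 1" "q \<noteq> 0"
  shows "qJ 2 q ^ 9 / (qJ 1 q ^ 6 * qJ 4 q ^ 2) = qJ 4 q ^ 12 * qJ 8 q / (qJ 2 q ^ 10 * qJ 16 q ^ 2)
    + 8 * q ^ 2 * (qJ 4 q ^ 2 * qJ 8 q ^ 3 * qJ 16 q ^ 2 / qJ 2 q ^ 6)
    + q * (2 * (qJ 4 q ^ 14 * qJ 16 q ^ 2 / (qJ 2 q ^ 10 * qJ 8 q ^ 5))
      + 4 * (qJ 8 q ^ 9 / (qJ 2 q ^ 6 * qJ 16 q ^ 2)))" (is "?l = ?r")
proof -
  have "?l = qJ 2 q ^ 9 / qJ 4 q ^ 2 * (1 / qJ 1 q ^ 4 * (1 / qJ 1 q ^ 2))"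
    by (simp flip: power_add)
  also have "\<dots> = ?r"
    unfolding inverse_qJ_1_power4[OF assms] inverse_qJ_1_power2[OF assms]
    by (simp add: field_simps qJ_nonzero[OF assms(1)]; algebra)
  finally show ?thesis .
qed

lemma bisect_over_qJ_1_power8:
  assumes "norm q < 1" "q \<noteq> 0"
  shows "qJ 2 q ^ 15 / (qJ 1 q ^ 8 * qJ 4 q ^ 6) = qJ 4 q ^ 22 / (qJ 2 q ^ 13 * qJ 8 q ^ 8)
    + 16 * q ^ 2 * (qJ 8 q ^ 8 / (qJ 2 q ^ 5 * qJ 4 q ^ 2)) + q * (8 * (qJ 4 q ^ 10 / qJ 2 q ^ 9))"
    (is "?l = ?r")
proof -
  have "?l = qJ 2 q ^ 15 / qJ 4 q ^ 6 * (1 / qJ 1 q ^ 4)\<^sup>2"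
    by (simp add: power_divide flip: power_mult)
  also have "\<dots> = ?r"
    unfolding inverse_qJ_1_power4[OF assms] power2_eq_square
    by (simp add: field_simps qJ_nonzero[OF assms(1)]; algebra)
  finally show ?thesis .
qed

lemma qJ_quotient_diff:
  assumes "norm q < 1" "q \<noteq> 0"
  shows "qJ 2 q ^ 9 / (qJ 1 q ^ 6 * qJ 4 q ^ 2) - qJ 2 q ^ 3 / qJ 1 q ^ 2
    = 4 * q * (qJ 2 q ^ 4 * qJ 16 q ^ 2 / (qJ 1 q ^ 4 * qJ 8 q))"
proof -
  have "qJ 2 q ^ 9 / (qJ 1 q ^ 6 * qJ 4 q ^ 2) - qJ 2 q ^ 3 / qJ 1 q ^ 2 =
      (phi q - phi (- q)) * (qJ 2 q ^ 4 / qJ 1 q ^ 4)"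
    unfolding phi_minus[OF assms] unfolding phi_def
    by (simp add: field_simps qJ_nonzero[OF assms(1)]; algebra)
  also have "\<dots> = 4 * q * (qJ 2 q ^ 4 * qJ 16 q ^ 2 / (qJ 1 q ^ 4 * qJ 8 q))"
    unfolding phi_bisection[OF assms] phi_minus_bisection[OF assms] by (simp add: mult_ac)
  finally show ?thesis .
qed

lemma qJ_quotient_sum:
  assumes "norm q < 1" "q \<noteq> 0"
  shows "qJ 2 q ^ 14 * qJ 8 q ^ 2 / (qJ 1 q ^ 10 * qJ 4 q ^ 5)
    + qJ 2 q ^ 2 * qJ 8 q ^ 2 / (qJ 1 q ^ 2 * qJ 4 q)
    = 2 * (qJ 4 q ^ 9 / (qJ 1 q ^ 6 * qJ 8 q ^ 2))"
proof -
  have "qJ 2 q ^ 14 * qJ 8 q ^ 2 / (qJ 1 q ^ 10 * qJ 4 q ^ 5)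
      + qJ 2 q ^ 2 * qJ 8 q ^ 2 / (qJ 1 q ^ 2 * qJ 4 q)
      = ((phi q)\<^sup>2 + (phi (- q))\<^sup>2) * (qJ 2 q ^ 4 * qJ 8 q ^ 2 / (qJ 1 q ^ 6 * qJ 4 q))"
    unfolding phi_minus[OF assms] unfolding phi_def
    by (simp add: field_simps qJ_nonzero[OF assms(1)]; algebra)
  also have "\<dots> = 2 * (qJ 4 q ^ 9 / (qJ 1 q ^ 6 * qJ 8 q ^ 2))"
    unfolding phi_square_sum[OF assms] phi_def[of "q\<^sup>2", unfolded qJ_power, simplified]
    by (simp add: field_simps qJ_nonzero[OF assms(1)]; algebra)
  finally show ?thesis .
qed

lemma bisect_qJ_quotient_add:
  assumes "norm q < 1" "q \<noteq> 0"
  shows "qJ 2 q ^ 9 / (qJ 1 q ^ 6 * qJ 4 q ^ 2) + qJ 2 q ^ 3 / qJ 1 q ^ 2 =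
    qJ 4 q ^ 12 * qJ 8 q / (qJ 2 q ^ 10 * qJ 16 q ^ 2)
    + 8 * q ^ 2 * (qJ 4 q ^ 2 * qJ 8 q ^ 3 * qJ 16 q ^ 2 / qJ 2 q ^ 6)
    + qJ 8 q ^ 5 / (qJ 2 q ^ 2 * qJ 16 q ^ 2)
    + q * (8 * (qJ 8 q ^ 9 / (qJ 2 q ^ 6 * qJ 16 q ^ 2)))"
proof -
  have q2: "norm (q\<^sup>2) < 1" "q\<^sup>2 \<noteq> 0"
    using assms by (simp_all add: norm_power_less_one)
  have "qJ 4 q ^ 14 * qJ 16 q ^ 2 / (qJ 2 q ^ 10 * qJ 8 q ^ 5)
      + qJ 4 q ^ 2 * qJ 16 q ^ 2 / (qJ 2 q ^ 2 * qJ 8 q)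
      = 2 * (qJ 8 q ^ 9 / (qJ 2 q ^ 6 * qJ 16 q ^ 2))"
    using qJ_quotient_sum[OF q2] unfolding qJ_power by simp
  moreover have "W + q * (2 * X + 4 * Y) + (V + q * (2 * Z)) = W + V + q * (8 * Y)"
    if "X + Z = 2 * Y" for V W X Y Z :: complex
    using that by algebra
  ultimately show ?thesis
    unfolding bisect_over_qJ_1_power6[OF assms] bisect_over_qJ_1_power2(1)[OF assms] by blast
qed

section \<open>The residues modulo 8\<close>

lemma mult_power_numeral:
  fixes q :: complex
  shows "q * q ^ numeral k = q ^ Suc (numeral k)"
    "q * (q ^ numeral k * x) = q ^ Suc (numeral k) * x"
  by (simp_all only: power_Suc mult.assoc)

lemma times_divide_power:
  fixes q :: complex
  shows "q * x / q\<^sup>2 = x / q" "q / q ^ 4 = 1 / q ^ 3" "q * x / q ^ 4 = x / q ^ 3"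
    "q * x / (y * (q ^ 4 * z)) = x / (y * (q ^ 3 * z))"
  by (simp_all add: eval_nat_numeral)

lemma dissection_residues_0_4:
  assumes "has_gf (\<lambda>n. c (2 * n + 1)) (\<lambda>q. q * m (q ^ 4)
    + 1/4 * (qJ 2 q ^ 8 * qJ 8 q ^ 2 / (qJ 1 q ^ 4 * qJ 4 q ^ 5)) + 1/4 * (qJ 4 q ^ 3 / qJ 2 q ^ 2)
    + e/2 * (qJ 2 q ^ 5 * qJ 16 q / (qJ 1 q ^ 2 * qJ 4 q ^ 2 * qJ 8 q))
    - 1/2 * q * (qJ 8 q ^ 8 * qJ 32 q ^ 2 / (qJ 4 q ^ 4 * qJ 16 q ^ 5))
    - e/2 * q * (qJ 16 q ^ 3 / qJ 8 q ^ 2))"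
  shows "has_gf (\<lambda>n. c (4 * n + 1))
      (\<lambda>q. 1/4 * (qJ 2 q ^ 9 / (qJ 1 q ^ 6 * qJ 4 q ^ 2) + qJ 2 q ^ 3 / qJ 1 q ^ 2)
        + e/2 * (qJ 4 q ^ 4 / (qJ 8 q * qJ 2 q ^ 2)))" (is "has_gf _ ?F1")
    and "has_gf (\<lambda>n. c (4 * n + 3))
      (\<lambda>q. m (q\<^sup>2) + e/2 * (qJ 8 q ^ 3 / qJ 4 q ^ 2) + qJ 4 q ^ 6 / (qJ 1 q ^ 2 * qJ 2 q ^ 3)
        - 1/2 * (qJ 4 q ^ 8 * qJ 16 q ^ 2 / (qJ 2 q ^ 4 * qJ 8 q ^ 5)))" (is "has_gf _ ?F3")
    and "has_gf (\<lambda>n. c (8 * n + 1))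
      (\<lambda>q. e/2 * (qJ 2 q ^ 4 / (qJ 1 q ^ 2 * qJ 4 q))
        + 1/4 * (qJ 4 q ^ 5 / (qJ 1 q ^ 2 * qJ 8 q ^ 2))
        + 1/4 * (qJ 2 q ^ 12 * qJ 4 q / (qJ 1 q ^ 10 * qJ 8 q ^ 2))
        + 2 * q * (qJ 2 q ^ 2 * qJ 4 q ^ 3 * qJ 8 q ^ 2 / qJ 1 q ^ 6))" (is "has_gf _ ?G1")
    and "has_gf (\<lambda>n. c (8 * n + 3))
      (\<lambda>q. m q + e/2 * (qJ 4 q ^ 3 / qJ 2 q ^ 2)
        - 1/2 * (qJ 2 q ^ 8 * qJ 8 q ^ 2 / (qJ 1 q ^ 4 * qJ 4 q ^ 5))
        + qJ 2 q ^ 6 * qJ 4 q ^ 5 / (qJ 1 q ^ 8 * qJ 8 q ^ 2))" (is "has_gf _ ?G3")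
    and "has_gf (\<lambda>n. c (8 * n + 5)) (\<lambda>q. 2 * (qJ 4 q ^ 9 / (qJ 1 q ^ 6 * qJ 8 q ^ 2)))"
      (is "has_gf _ ?G5")
    and "has_gf (\<lambda>n. c (8 * n + 7)) (\<lambda>q. 2 * (qJ 2 q ^ 8 * qJ 8 q ^ 2 / (qJ 1 q ^ 8 * qJ 4 q)))"
      (is "has_gf _ ?G7")
proof -
  have mod4: "has_gf (\<lambda>n. c (4 * n + 1)) ?F1 \<and> has_gf (\<lambda>n. c (4 * n + 3)) ?F3"
  proof (rule has_gf_bisect[OF assms], goal_cases)
    case (1 q)
    show ?case
      unfolding bisect_over_qJ_1_power4(1)[OF 1] bisect_over_qJ_1_power2(3)[OF 1]
      by (simp add: qJ_power_simps algebra_simps mult_power_numeral flip: power_mult)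
  qed (rule arg_cong[where f = c], simp)+
  then show "has_gf (\<lambda>n. c (4 * n + 1)) ?F1" "has_gf (\<lambda>n. c (4 * n + 3)) ?F3"
    by auto
  have "has_gf (\<lambda>n. c (8 * n + 1)) ?G1 \<and> has_gf (\<lambda>n. c (8 * n + 5)) ?G5"
  proof (rule has_gf_bisect[OF mod4[THEN conjunct1]], goal_cases)
    case (1 q)
    show ?case
      unfolding bisect_qJ_quotient_add[OF 1]
      by (simp add: qJ_power_simps algebra_simps mult_power_numeral flip: power_mult)
  qed (rule arg_cong[where f = c], simp)+
  then show "has_gf (\<lambda>n. c (8 * n + 1)) ?G1" "has_gf (\<lambda>n. c (8 * n + 5)) ?G5"
    by auto
  have "has_gf (\<lambda>n. c (8 * n + 3)) ?G3 \<and> has_gf (\<lambda>n. c (8 * n + 7)) ?G7"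
  proof (rule has_gf_bisect[OF mod4[THEN conjunct2]], goal_cases)
    case (1 q)
    show ?case
      unfolding bisect_over_qJ_1_power2(2)[OF 1]
      by (simp add: qJ_power_simps algebra_simps mult_power_numeral flip: power_mult)
  qed (rule arg_cong[where f = c], simp)+
  then show "has_gf (\<lambda>n. c (8 * n + 3)) ?G3" "has_gf (\<lambda>n. c (8 * n + 7)) ?G7"
    by auto
qed

lemma dissection_residues_1_3:
  assumes "has_gf (\<lambda>n. c (2 * n)) (\<lambda>q. m (q ^ 4)
    + 1/8 * (qJ 2 q ^ 6 * qJ 4 q / (qJ 1 q ^ 4 * qJ 8 q ^ 2))
    - e/4 * (qJ 8 q ^ 7 / (qJ 4 q ^ 3 * qJ 16 q ^ 3))
    + e/4 * (qJ 2 q ^ 5 * qJ 8 q ^ 2 / (qJ 1 q ^ 2 * qJ 4 q ^ 3 * qJ 16 q)))"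
  shows "has_gf (\<lambda>n. c (4 * n)) (\<lambda>q. m (q\<^sup>2) + 1/8 * (qJ 2 q ^ 15 / (qJ 1 q ^ 8 * qJ 4 q ^ 6)))"
      (is "has_gf _ ?F0")
    and "has_gf (\<lambda>n. c (4 * n + 2))
      (\<lambda>q. 1/2 * (qJ 2 q ^ 3 * qJ 4 q ^ 2 / qJ 1 q ^ 4) + e/2 * (qJ 4 q * qJ 8 q / qJ 2 q))"
      (is "has_gf _ ?F2")
    and "has_gf (\<lambda>n. c (8 * n)) (\<lambda>q. m q + 1/8 * (qJ 2 q ^ 22 / (qJ 1 q ^ 13 * qJ 4 q ^ 8))
      + 2 * q * (qJ 4 q ^ 8 / (qJ 1 q ^ 5 * qJ 2 q ^ 2)))" (is "has_gf _ ?G0")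
    and "has_gf (\<lambda>n. c (8 * n + 2))
      (\<lambda>q. 1/2 * (qJ 2 q ^ 16 / (qJ 1 q ^ 11 * qJ 4 q ^ 4)) + e/2 * (qJ 2 q * qJ 4 q / qJ 1 q))"
      (is "has_gf _ ?G2")
    and "has_gf (\<lambda>n. c (8 * n + 4)) (\<lambda>q. qJ 2 q ^ 10 / qJ 1 q ^ 9)" (is "has_gf _ ?G4")
    and "has_gf (\<lambda>n. c (8 * n + 6)) (\<lambda>q. 2 * (qJ 2 q ^ 4 * qJ 4 q ^ 4 / qJ 1 q ^ 7))"
      (is "has_gf _ ?G6")
proof -
  have mod4: "has_gf (\<lambda>n. c (4 * n)) ?F0 \<and> has_gf (\<lambda>n. c (4 * n + 2)) ?F2"
  proof (rule has_gf_bisect[OF assms], goal_cases)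
    case (1 q)
    show ?case
      unfolding bisect_over_qJ_1_power4(2)[OF 1] bisect_over_qJ_1_power2(4)[OF 1]
      by (simp add: qJ_power_simps algebra_simps mult_power_numeral flip: power_mult)
  qed (rule arg_cong[where f = c], simp)+
  then show "has_gf (\<lambda>n. c (4 * n)) ?F0" "has_gf (\<lambda>n. c (4 * n + 2)) ?F2"
    by auto
  have "has_gf (\<lambda>n. c (8 * n)) ?G0 \<and> has_gf (\<lambda>n. c (8 * n + 4)) ?G4"
  proof (rule has_gf_bisect[OF mod4[THEN conjunct1]], goal_cases)
    case (1 q)
    show ?case
      unfolding bisect_over_qJ_1_power8[OF 1]
      by (simp add: qJ_power_simps algebra_simps mult_power_numeral flip: power_mult)
  qed (rule arg_cong[where f = c], simp)+
  then show "has_gf (\<lambda>n. c (8 * n)) ?G0" "has_gf (\<lambda>n. c (8 * n + 4)) ?G4"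
    by auto
  have "has_gf (\<lambda>n. c (8 * n + 2)) ?G2 \<and> has_gf (\<lambda>n. c (8 * n + 6)) ?G6"
  proof (rule has_gf_bisect[OF mod4[THEN conjunct2]], goal_cases)
    case (1 q)
    show ?case
      unfolding bisect_over_qJ_1_power4(3)[OF 1]
      by (simp add: qJ_power_simps algebra_simps mult_power_numeral flip: power_mult)
  qed (rule arg_cong[where f = c], simp)+
  then show "has_gf (\<lambda>n. c (8 * n + 2)) ?G2" "has_gf (\<lambda>n. c (8 * n + 6)) ?G6"
    by auto
qed

lemma dissection_residue_2:
  assumes "has_gf (\<lambda>n. c (2 * n + 1)) (\<lambda>q. m (q ^ 4) / q
    + 1/4 * (qJ 2 q ^ 8 * qJ 8 q ^ 2 / (qJ 1 q ^ 4 * qJ 4 q ^ 5))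
    - 1/4 * (qJ 4 q ^ 3 / qJ 2 q ^ 2))"
  shows "has_gf (\<lambda>n. c (4 * n + 1)) (\<lambda>q. q * (qJ 2 q ^ 4 * qJ 16 q ^ 2 / (qJ 1 q ^ 4 * qJ 8 q)))"
      (is "has_gf _ ?F1")
    and "has_gf (\<lambda>n. c (4 * n + 3)) (\<lambda>q. m (q\<^sup>2) / q + qJ 4 q ^ 6 / (qJ 1 q ^ 2 * qJ 2 q ^ 3))"
      (is "has_gf _ ?F3")
    and "has_gf (\<lambda>n. c (8 * n + 1))
      (\<lambda>q. 4 * q * (qJ 2 q ^ 2 * qJ 4 q ^ 3 * qJ 8 q ^ 2 / qJ 1 q ^ 6))"
      (is "has_gf _ ?G1")
    and "has_gf (\<lambda>n. c (8 * n + 3)) (\<lambda>q. qJ 2 q ^ 6 * qJ 4 q ^ 5 / (qJ 1 q ^ 8 * qJ 8 q ^ 2))"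
      (is "has_gf _ ?G3")
    and "has_gf (\<lambda>n. c (8 * n + 5)) (\<lambda>q. qJ 2 q ^ 14 * qJ 8 q ^ 2 / (qJ 1 q ^ 10 * qJ 4 q ^ 5))"
      (is "has_gf _ ?G5")
    and "has_gf (\<lambda>n. c (8 * n + 7))
      (\<lambda>q. m q / q + 2 * (qJ 2 q ^ 8 * qJ 8 q ^ 2 / (qJ 1 q ^ 8 * qJ 4 q)))"
      (is "has_gf _ ?G7")
proof -
  have mod4: "has_gf (\<lambda>n. c (4 * n + 1)) ?F1 \<and> has_gf (\<lambda>n. c (4 * n + 3)) ?F3"
  proof (rule has_gf_bisect[OF assms], goal_cases)
    case (1 q)
    then have "norm (q\<^sup>2) < 1" "q\<^sup>2 \<noteq> 0"
      by (simp_all add: norm_power_less_one)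
    from qJ_quotient_diff[OF this] show ?case
      unfolding bisect_over_qJ_1_power4(1)[OF 1]
      by (simp add: qJ_power_simps algebra_simps mult_power_numeral times_divide_power
          flip: power_mult)
  qed (rule arg_cong[where f = c], simp)+
  then show "has_gf (\<lambda>n. c (4 * n + 1)) ?F1" "has_gf (\<lambda>n. c (4 * n + 3)) ?F3"
    by auto
  have "has_gf (\<lambda>n. c (8 * n + 1)) ?G1 \<and> has_gf (\<lambda>n. c (8 * n + 5)) ?G5"
  proof (rule has_gf_bisect[OF mod4[THEN conjunct1]], goal_cases)
    case (1 q)
    show ?case
      unfolding bisect_over_qJ_1_power4(4)[OF 1]
      by (simp add: qJ_power_simps algebra_simps mult_power_numeral
          power2_eq_square[of q, symmetric] flip: power_mult)
  qed (rule arg_cong[where f = c], simp)+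
  then show "has_gf (\<lambda>n. c (8 * n + 1)) ?G1" "has_gf (\<lambda>n. c (8 * n + 5)) ?G5"
    by auto
  have "has_gf (\<lambda>n. c (8 * n + 3)) ?G3 \<and> has_gf (\<lambda>n. c (8 * n + 7)) ?G7"
  proof (rule has_gf_bisect[OF mod4[THEN conjunct2]], goal_cases)
    case (1 q)
    show ?case
      unfolding bisect_over_qJ_1_power2(2)[OF 1]
      by (simp add: qJ_power_simps algebra_simps mult_power_numeral times_divide_power
          flip: power_mult)
  qed (rule arg_cong[where f = c], simp)+
  then show "has_gf (\<lambda>n. c (8 * n + 3)) ?G3" "has_gf (\<lambda>n. c (8 * n + 7)) ?G7"
    by auto
qed

definition mock_part_even :: "complex \<Rightarrow> complex \<Rightarrow> complex" where
  "mock_part_even e q = (odd_rank_gf (- 1) (q\<^sup>2) + e * odd_rank_gf 1 (q\<^sup>2)) / (2 * q)"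

definition mock_part_odd :: "complex \<Rightarrow> complex \<Rightarrow> complex" where
  "mock_part_odd e q = - 1/4 + 1/4 * mock_g (- 1) q + e/2 * q * mock_g q (q ^ 4)"

definition mock_part_2 :: "complex \<Rightarrow> complex" where
  "mock_part_2 q = - 1/2 + 1/2 * mock_g (- 1) (q ^ 4)
    + 1/4 * (qJ 2 q ^ 6 * qJ 4 q / (qJ 1 q ^ 4 * qJ 8 q ^ 2))"

lemma mock_part_even_1:
  assumes "norm q < 1" "q \<noteq> 0"
  shows "mock_part_even 1 q = - (q ^ 5) * mock_g (- (q ^ 8)) (q ^ 16)
    + q * (qJ 8 q ^ 8 * qJ 32 q ^ 2 / (qJ 4 q ^ 4 * qJ 16 q ^ 5))"
proof -
  have q2: "norm (q\<^sup>2) < 1" "q\<^sup>2 \<noteq> 0"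
    using assms by (simp_all add: norm_power_less_one)
  define G J where "G = mock_g (- (q ^ 8)) (q ^ 16)"
    and "J = qJ 8 q ^ 8 * qJ 32 q ^ 2 / (qJ 4 q ^ 4 * qJ 16 q ^ 5)"
  have "odd_rank_gf (- 1) (q\<^sup>2) + 1 * odd_rank_gf 1 (q\<^sup>2) = - 2 / q\<^sup>2 * (q ^ 8 * G) + 2 * q\<^sup>2 * J"
    using odd_rank_gf_sum_1[OF q2]
    by (simp add: odd_rank_gf_def[of "- 1" "q ^ 8"] G_def J_def qJ_power_simps
        add.commute flip: power_mult)
  also have "\<dots> = 2 * q * (- (q ^ 5) * G + q * J)"
    using assms(2) by (simp add: field_simps eval_nat_numeral)
  finally show ?thesis
    using assms(2) by (simp add: mock_part_even_def G_def J_def)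
qed

lemma odd_rank_gf_diff_1_eq_mock_part:
  assumes "norm q < 1" "q \<noteq> 0"
  shows "odd_rank_gf 1 q - odd_rank_gf (- 1) q = 4 * mock_part_2 (q\<^sup>2)"
  using odd_rank_gf_diff_1[OF assms]
  by (simp add: mock_part_2_def qJ_power_simps flip: power_mult)

lemma mock_part_even_minus_1:
  assumes "norm q < 1" "q \<noteq> 0"
  shows "mock_part_even (- 1) q = - 2 / q * mock_part_2 (q ^ 4)"
proof -
  have "odd_rank_gf (- 1) (q\<^sup>2) + - 1 * odd_rank_gf 1 (q\<^sup>2) = - (4 * mock_part_2 (q ^ 4))"
    using odd_rank_gf_diff_1_eq_mock_part[of "q\<^sup>2"] assms
    by (simp add: norm_power_less_one algebra_simps flip: power_mult)
  then show ?thesis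
    unfolding mock_part_even_def by simp
qed

lemma N0_0_4_odd_has_gf:
  assumes "(a, e) \<in> {(0, 1), (4, - 1)}"
  shows "has_gf (\<lambda>n. of_nat (N0 a 8 (2 * n + 1))) (\<lambda>q. q * mock_part_even e (q ^ 4)
    + 1/4 * (qJ 2 q ^ 8 * qJ 8 q ^ 2 / (qJ 1 q ^ 4 * qJ 4 q ^ 5)) + 1/4 * (qJ 4 q ^ 3 / qJ 2 q ^ 2)
    + e/2 * (qJ 2 q ^ 5 * qJ 16 q / (qJ 1 q ^ 2 * qJ 4 q ^ 2 * qJ 8 q))
    - 1/2 * q * (qJ 8 q ^ 8 * qJ 32 q ^ 2 / (qJ 4 q ^ 4 * qJ 16 q ^ 5))
    - e/2 * q * (qJ 16 q ^ 3 / qJ 8 q ^ 2))"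
proof (rule has_gf_bisect[OF N0_8_has_gf_0_4[OF assms], where A = "\<lambda>_. 0"
      and a = "\<lambda>n. of_nat (N0 a 8 (2 * n))", THEN conjunct2], goal_cases)
  case q: (1 q)
  have mock: "odd_rank_gf (- 1) (q ^ 16) =
      2 * q ^ 8 * mock_part_even e (q ^ 8) - e * odd_rank_gf 1 (q ^ 16)"
    using q(2) by (simp add: mock_part_even_def flip: power_mult)
  have cancel: "4 / q ^ 5 * (2 * q ^ 8 * x - e * y) = 8 * q ^ 3 * x - e * (4 / q ^ 5 * y)" for x y
    using q(2) by (simp add: field_simps eval_nat_numeral)
  show ?case
    unfolding odd_rank_gf_sum_1_ii[OF q] odd_rank_gf_sum_zeta8[OF q] mock cancel
    by (simp add: qJ_power_simps algebra_simps mult_power_numeral flip: power_mult)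
qed simp_all

lemma N0_1_3_even_has_gf:
  assumes "(a, e) \<in> {(1, 1), (3, - 1)}"
  shows "has_gf (\<lambda>n. of_nat (N0 a 8 (2 * n))) (\<lambda>q. mock_part_odd e (q ^ 4)
    + 1/8 * (qJ 2 q ^ 6 * qJ 4 q / (qJ 1 q ^ 4 * qJ 8 q ^ 2))
    - e/4 * (qJ 8 q ^ 7 / (qJ 4 q ^ 3 * qJ 16 q ^ 3))
    + e/4 * (qJ 2 q ^ 5 * qJ 8 q ^ 2 / (qJ 1 q ^ 2 * qJ 4 q ^ 3 * qJ 16 q)))"
proof (rule has_gf_bisect[OF N0_8_has_gf_1_3[OF assms], where B = "\<lambda>_. 0"
      and b = "\<lambda>n. of_nat (N0 a 8 (2 * n + 1))", THEN conjunct1], goal_cases)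
  case (1 q)
  show ?case
    unfolding odd_rank_gf_diff_1[OF 1] odd_rank_gf_diff_zeta8[OF 1] mock_part_odd_def
    by (simp add: qJ_power_simps algebra_simps flip: power_mult power_Suc)
qed simp_all

lemma N0_2_odd_has_gf:
  "has_gf (\<lambda>n. of_nat (N0 2 8 (2 * n + 1))) (\<lambda>q. mock_part_2 (q ^ 4) / q
    + 1/4 * (qJ 2 q ^ 8 * qJ 8 q ^ 2 / (qJ 1 q ^ 4 * qJ 4 q ^ 5))
    - 1/4 * (qJ 4 q ^ 3 / qJ 2 q ^ 2))"
proof (rule has_gf_bisect[OF N0_8_has_gf_2, where A = "\<lambda>_. 0"
      and a = "\<lambda>n. of_nat (N0 2 8 (2 * n))", THEN conjunct2], goal_cases)
  case (1 q)
  then have "odd_rank_gf 1 (q ^ 4) = odd_rank_gf (- 1) (q ^ 4) + 4 * mock_part_2 (q ^ 8)"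
    using odd_rank_gf_diff_1_eq_mock_part[of "q ^ 4"]
    by (simp add: norm_power_less_one algebra_simps flip: power_mult)
  then show ?case
    unfolding odd_rank_gf_sum_1[OF 1] odd_rank_gf_ii[OF 1]
    by (simp add: qJ_power_simps algebra_simps times_divide_power flip: power_mult)
qed simp_all

lemma powi_minus_numeral:
  fixes q :: complex
  shows "q powi (- 1) = 1 / q" "q powi (- numeral k) = 1 / q ^ numeral k"
  by (simp_all add: power_int_minus divide_inverse)

lemma sums_eq_rhs:
  assumes "f sums s" "s = t"
  shows "f sums t"
  using assms by simp

theorem theorem3p3:
  fixes q :: complex
  assumes "q \<noteq> 0" and "norm q < 1"
  shows "
     ((\<lambda>n. of_nat (N0 0 8 (2 * n + 1)) * q ^ n) sums
        (- (q ^ 21) * mock_g (- (q ^ 32)) (q ^ 64)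
         + q ^ 5 * (qJ 32 q ^ 8 * qJ 128 q ^ 2 / (qJ 16 q ^ 4 * qJ 64 q ^ 5))
         + 1/4 * (qJ 2 q ^ 8 * qJ 8 q ^ 2 / (qJ 1 q ^ 4 * qJ 4 q ^ 5))
         + 1/4 * (qJ 4 q ^ 3 / qJ 2 q ^ 2)
         + 1/2 * (qJ 2 q ^ 5 * qJ 16 q / (qJ 1 q ^ 2 * qJ 4 q ^ 2 * qJ 8 q))
         - 1/2 * q * (qJ 8 q ^ 8 * qJ 32 q ^ 2 / (qJ 4 q ^ 4 * qJ 16 q ^ 5))
         - 1/2 * q * (qJ 16 q ^ 3 / qJ 8 q ^ 2)) \<and>
      (\<lambda>n. of_nat (N0 0 8 (4 * n + 1)) * q ^ n) sums
        (1/4 * ((qJ 2 q ^ 9 / (qJ 1 q ^ 6 * qJ 4 q ^ 2)) + (qJ 2 q ^ 3 / qJ 1 q ^ 2)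
                + 2 * (qJ 4 q ^ 4 / (qJ 8 q * qJ 2 q ^ 2)))) \<and>
      (\<lambda>n. of_nat (N0 0 8 (4 * n + 3)) * q ^ n) sums
        (- (q ^ 10) * mock_g (- (q ^ 16)) (q ^ 32)
         + q ^ 2 * (qJ 16 q ^ 8 * qJ 64 q ^ 2 / (qJ 8 q ^ 4 * qJ 32 q ^ 5))
         + 1/2 * (qJ 8 q ^ 3 / qJ 4 q ^ 2) + (qJ 4 q ^ 6 / (qJ 1 q ^ 2 * qJ 2 q ^ 3))
         - 1/2 * (qJ 4 q ^ 8 * qJ 16 q ^ 2 / (qJ 2 q ^ 4 * qJ 8 q ^ 5))) \<and>
      (\<lambda>n. of_nat (N0 0 8 (8 * n + 1)) * q ^ n) sums
        (1/2 * (qJ 2 q ^ 4 / (qJ 1 q ^ 2 * qJ 4 q))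
         + 1/4 * (qJ 4 q ^ 5 / (qJ 1 q ^ 2 * qJ 8 q ^ 2))
         + 1/4 * (qJ 2 q ^ 12 * qJ 4 q / (qJ 1 q ^ 10 * qJ 8 q ^ 2))
         + 2 * q * (qJ 2 q ^ 2 * qJ 4 q ^ 3 * qJ 8 q ^ 2 / qJ 1 q ^ 6)) \<and>
      (\<lambda>n. of_nat (N0 0 8 (8 * n + 3)) * q ^ n) sums
        (- (q ^ 5) * mock_g (- (q ^ 8)) (q ^ 16)
         + q * (qJ 8 q ^ 8 * qJ 32 q ^ 2 / (qJ 4 q ^ 4 * qJ 16 q ^ 5))
         + 1/2 * (qJ 4 q ^ 3 / qJ 2 q ^ 2)
         - 1/2 * (qJ 2 q ^ 8 * qJ 8 q ^ 2 / (qJ 1 q ^ 4 * qJ 4 q ^ 5))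
         + (qJ 2 q ^ 6 * qJ 4 q ^ 5 / (qJ 1 q ^ 8 * qJ 8 q ^ 2))) \<and>
      (\<lambda>n. of_nat (N0 0 8 (8 * n + 5)) * q ^ n) sums
        (2 * (qJ 4 q ^ 9 / (qJ 1 q ^ 6 * qJ 8 q ^ 2))) \<and>
      (\<lambda>n. of_nat (N0 0 8 (8 * n + 7)) * q ^ n) sums
        (2 * (qJ 2 q ^ 8 * qJ 8 q ^ 2 / (qJ 1 q ^ 8 * qJ 4 q)))) \<and>
     ((\<lambda>n. of_nat (N0 1 8 (2 * n)) * q ^ n) sums
        (- 1/4 + 1/4 * mock_g (-1) (q ^ 4) + 1/2 * q ^ 4 * mock_g (q ^ 4) (q ^ 16)
         + 1/8 * (qJ 2 q ^ 6 * qJ 4 q / (qJ 1 q ^ 4 * qJ 8 q ^ 2))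
         - 1/4 * (qJ 8 q ^ 7 / (qJ 4 q ^ 3 * qJ 16 q ^ 3))
         + 1/4 * (qJ 2 q ^ 5 * qJ 8 q ^ 2 / (qJ 1 q ^ 2 * qJ 4 q ^ 3 * qJ 16 q))) \<and>
      (\<lambda>n. of_nat (N0 1 8 (4 * n)) * q ^ n) sums
        (- 1/4 + 1/4 * mock_g (-1) (q ^ 2) + 1/2 * q ^ 2 * mock_g (q ^ 2) (q ^ 8)
         + 1/8 * (qJ 2 q ^ 15 / (qJ 1 q ^ 8 * qJ 4 q ^ 6))) \<and>
      (\<lambda>n. of_nat (N0 1 8 (4 * n + 2)) * q ^ n) sums
        (1/2 * ((qJ 2 q ^ 3 * qJ 4 q ^ 2 / qJ 1 q ^ 4) + (qJ 4 q * qJ 8 q / qJ 2 q))) \<and>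
      (\<lambda>n. of_nat (N0 1 8 (8 * n)) * q ^ n) sums
        (- 1/4 + 1/4 * mock_g (-1) q + 1/2 * q * mock_g q (q ^ 4)
         + 1/8 * (qJ 2 q ^ 22 / (qJ 1 q ^ 13 * qJ 4 q ^ 8))
         + 2 * q * (qJ 4 q ^ 8 / (qJ 1 q ^ 5 * qJ 2 q ^ 2))) \<and>
      (\<lambda>n. of_nat (N0 1 8 (8 * n + 2)) * q ^ n) sums
        (1/2 * ((qJ 2 q ^ 16 / (qJ 1 q ^ 11 * qJ 4 q ^ 4)) + (qJ 2 q * qJ 4 q / qJ 1 q))) \<and>
      (\<lambda>n. of_nat (N0 1 8 (8 * n + 4)) * q ^ n) sums
        (qJ 2 q ^ 10 / qJ 1 q ^ 9) \<and>
      (\<lambda>n. of_nat (N0 1 8 (8 * n + 6)) * q ^ n) sums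
        (2 * (qJ 2 q ^ 4 * qJ 4 q ^ 4 / qJ 1 q ^ 7))) \<and>
     ((\<lambda>n. of_nat (N0 2 8 (2 * n + 1)) * q ^ n) sums
        (- 1/2 * q powi (-1) + 1/2 * q powi (-1) * mock_g (-1) (q ^ 16)
         + 1/4 * q powi (-1) * (qJ 8 q ^ 6 * qJ 16 q / (qJ 4 q ^ 4 * qJ 32 q ^ 2))
         + 1/4 * (qJ 2 q ^ 8 * qJ 8 q ^ 2 / (qJ 4 q ^ 5 * qJ 1 q ^ 4))
         - 1/4 * (qJ 4 q ^ 3 / qJ 2 q ^ 2)) \<and>
      (\<lambda>n. of_nat (N0 2 8 (4 * n + 1)) * q ^ n) sums
        (q * (qJ 2 q ^ 4 * qJ 16 q ^ 2 / (qJ 1 q ^ 4 * qJ 8 q))) \<and>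
      (\<lambda>n. of_nat (N0 2 8 (4 * n + 3)) * q ^ n) sums
        (- 1/2 * q powi (-1) + 1/2 * q powi (-1) * mock_g (-1) (q ^ 8)
         + 1/4 * q powi (-1) * (qJ 4 q ^ 6 * qJ 8 q / (qJ 2 q ^ 4 * qJ 16 q ^ 2))
         + (qJ 4 q ^ 6 / (qJ 1 q ^ 2 * qJ 2 q ^ 3))) \<and>
      (\<lambda>n. of_nat (N0 2 8 (8 * n + 1)) * q ^ n) sums
        (4 * q * (qJ 2 q ^ 2 * qJ 4 q ^ 3 * qJ 8 q ^ 2 / qJ 1 q ^ 6)) \<and>
      (\<lambda>n. of_nat (N0 2 8 (8 * n + 3)) * q ^ n) sums
        (qJ 2 q ^ 6 * qJ 4 q ^ 5 / (qJ 1 q ^ 8 * qJ 8 q ^ 2)) \<and>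
      (\<lambda>n. of_nat (N0 2 8 (8 * n + 5)) * q ^ n) sums
        (qJ 2 q ^ 14 * qJ 8 q ^ 2 / (qJ 1 q ^ 10 * qJ 4 q ^ 5)) \<and>
      (\<lambda>n. of_nat (N0 2 8 (8 * n + 7)) * q ^ n) sums
        (- 1/2 * q powi (-1) + 1/2 * q powi (-1) * mock_g (-1) (q ^ 4)
         + 1/4 * q powi (-1) * (qJ 2 q ^ 6 * qJ 4 q / (qJ 1 q ^ 4 * qJ 8 q ^ 2))
         + 2 * (qJ 2 q ^ 8 * qJ 8 q ^ 2 / (qJ 1 q ^ 8 * qJ 4 q)))) \<and>
     ((\<lambda>n. of_nat (N0 3 8 (2 * n)) * q ^ n) sums
        (- 1/4 + 1/4 * mock_g (-1) (q ^ 4) - 1/2 * q ^ 4 * mock_g (q ^ 4) (q ^ 16)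
         + 1/4 * (qJ 8 q ^ 7 / (qJ 4 q ^ 3 * qJ 16 q ^ 3))
         - 1/4 * (qJ 2 q ^ 5 * qJ 8 q ^ 2 / (qJ 1 q ^ 2 * qJ 4 q ^ 3 * qJ 16 q))
         + 1/8 * (qJ 2 q ^ 6 * qJ 4 q / (qJ 1 q ^ 4 * qJ 8 q ^ 2))) \<and>
      (\<lambda>n. of_nat (N0 3 8 (4 * n)) * q ^ n) sums
        (- 1/4 + 1/4 * mock_g (-1) (q ^ 2) - 1/2 * q ^ 2 * mock_g (q ^ 2) (q ^ 8)
         + 1/4 * (qJ 4 q ^ 7 / (qJ 2 q ^ 3 * qJ 8 q ^ 3))
         - 1/4 * (qJ 4 q ^ 7 / (qJ 2 q ^ 3 * qJ 8 q ^ 3))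
         + 1/8 * (qJ 2 q ^ 15 / (qJ 4 q ^ 6 * qJ 1 q ^ 8))) \<and>
      (\<lambda>n. of_nat (N0 3 8 (4 * n + 2)) * q ^ n) sums
        (1/2 * ((qJ 2 q ^ 3 * qJ 4 q ^ 2 / qJ 1 q ^ 4) - (qJ 4 q * qJ 8 q / qJ 2 q))) \<and>
      (\<lambda>n. of_nat (N0 3 8 (8 * n)) * q ^ n) sums
        (- 1/4 + 1/4 * mock_g (-1) q - 1/2 * q * mock_g q (q ^ 4)
         + 1/8 * (qJ 2 q ^ 22 / (qJ 1 q ^ 13 * qJ 4 q ^ 8))
         + 2 * q * (qJ 4 q ^ 8 / (qJ 1 q ^ 5 * qJ 2 q ^ 2))) \<and>
      (\<lambda>n. of_nat (N0 3 8 (8 * n + 2)) * q ^ n) sums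
        (1/2 * ((qJ 2 q ^ 16 / (qJ 1 q ^ 11 * qJ 4 q ^ 4)) - (qJ 2 q * qJ 4 q / qJ 1 q))) \<and>
      (\<lambda>n. of_nat (N0 3 8 (8 * n + 4)) * q ^ n) sums
        (qJ 2 q ^ 10 / qJ 1 q ^ 9) \<and>
      (\<lambda>n. of_nat (N0 3 8 (8 * n + 6)) * q ^ n) sums
        (2 * (qJ 2 q ^ 4 * qJ 4 q ^ 4 / qJ 1 q ^ 7))) \<and>
     ((\<lambda>n. of_nat (N0 4 8 (2 * n + 1)) * q ^ n) sums
        (q powi (-3) - q powi (-3) * mock_g (-1) (q ^ 64)
         - 1/2 * q powi (-3) * (qJ 32 q ^ 6 * qJ 64 q / (qJ 16 q ^ 4 * qJ 128 q ^ 2))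
         + 1/4 * ((qJ 2 q ^ 8 * qJ 8 q ^ 2 / (qJ 1 q ^ 4 * qJ 4 q ^ 5))
                  - 2 * (qJ 2 q ^ 5 * qJ 16 q / (qJ 1 q ^ 2 * qJ 4 q ^ 2 * qJ 8 q))
                  + (qJ 4 q ^ 3 / qJ 2 q ^ 2))
         + 1/2 * q * ((qJ 16 q ^ 3 / qJ 8 q ^ 2)
                      - (qJ 8 q ^ 8 * qJ 32 q ^ 2 / (qJ 4 q ^ 4 * qJ 16 q ^ 5)))) \<and>
      (\<lambda>n. of_nat (N0 4 8 (4 * n + 1)) * q ^ n) sums
        (1/4 * ((qJ 2 q ^ 9 / (qJ 1 q ^ 6 * qJ 4 q ^ 2))
                - 2 * (qJ 4 q ^ 4 / (qJ 2 q ^ 2 * qJ 8 q)) + (qJ 2 q ^ 3 / qJ 1 q ^ 2))) \<and>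
      (\<lambda>n. of_nat (N0 4 8 (4 * n + 3)) * q ^ n) sums
        (q powi (-2) - q powi (-2) * mock_g (-1) (q ^ 32)
         - 1/2 * q powi (-2) * (qJ 16 q ^ 6 * qJ 32 q / (qJ 8 q ^ 4 * qJ 64 q ^ 2))
         - 1/2 * (qJ 8 q ^ 3 / qJ 4 q ^ 2)
         - 1/2 * (qJ 4 q ^ 8 * qJ 16 q ^ 2 / (qJ 2 q ^ 4 * qJ 8 q ^ 5))
         + (qJ 4 q ^ 6 / (qJ 2 q ^ 3 * qJ 1 q ^ 2))) \<and>
      (\<lambda>n. of_nat (N0 4 8 (8 * n + 1)) * q ^ n) sums
        (1/4 * (qJ 2 q ^ 12 * qJ 4 q / (qJ 1 q ^ 10 * qJ 8 q ^ 2))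
         + 2 * q * (qJ 2 q ^ 2 * qJ 4 q ^ 3 * qJ 8 q ^ 2 / qJ 1 q ^ 6)
         - 1/2 * (qJ 2 q ^ 4 / (qJ 1 q ^ 2 * qJ 4 q))
         + 1/4 * (qJ 4 q ^ 5 / (qJ 1 q ^ 2 * qJ 8 q ^ 2))) \<and>
      (\<lambda>n. of_nat (N0 4 8 (8 * n + 3)) * q ^ n) sums
        (q powi (-1) - q powi (-1) * mock_g (-1) (q ^ 16)
         - 1/2 * q powi (-1) * (qJ 8 q ^ 6 * qJ 16 q / (qJ 4 q ^ 4 * qJ 32 q ^ 2))
         - 1/2 * (qJ 4 q ^ 3 / qJ 2 q ^ 2)
         - 1/2 * (qJ 2 q ^ 8 * qJ 8 q ^ 2 / (qJ 1 q ^ 4 * qJ 4 q ^ 5))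
         + (qJ 2 q ^ 6 * qJ 4 q ^ 5 / (qJ 1 q ^ 8 * qJ 8 q ^ 2))) \<and>
      (\<lambda>n. of_nat (N0 4 8 (8 * n + 5)) * q ^ n) sums
        (2 * (qJ 4 q ^ 9 / (qJ 1 q ^ 6 * qJ 8 q ^ 2))) \<and>
      (\<lambda>n. of_nat (N0 4 8 (8 * n + 7)) * q ^ n) sums
        (2 * (qJ 2 q ^ 8 * qJ 8 q ^ 2 / (qJ 1 q ^ 8 * qJ 4 q))))"
proof -
  note q = assms(2,1)
  have cases: "(0, 1) \<in> {(0, 1), (4, - 1)}" "(4, - 1) \<in> {(0, 1), (4, - 1)}"
    "(1, 1) \<in> {(1, 1), (3, - 1)}" "(3, - 1) \<in> {(1, 1), (3, - 1)}"
    by simp_all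
  note residue_0 = N0_0_4_odd_has_gf[OF cases(1)] and residue_4 = N0_0_4_odd_has_gf[OF cases(2)]
    and residue_1 = N0_1_3_even_has_gf[OF cases(3)] and residue_3 = N0_1_3_even_has_gf[OF cases(4)]
  note gfs =
    residue_0 dissection_residues_0_4[OF residue_0]
    residue_1 dissection_residues_1_3[OF residue_1]
    N0_2_odd_has_gf dissection_residue_2[OF N0_2_odd_has_gf]
    residue_3 dissection_residues_1_3[OF residue_3]
    residue_4 dissection_residues_0_4[OF residue_4]
  show ?thesis
    by (intro conjI gfs[THEN has_gfD, THEN sums_eq_rhs, OF q];
        simp add: mock_part_even_1 mock_part_even_minus_1 mock_part_odd_def mock_part_2_def
          q norm_power_less_one powi_minus_numeral inverse_eq_divide add_divide_distrib
          diff_divide_distrib qJ_power_simps algebra_simps mult_power_numeral times_divide_power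
          flip: power_mult)
qed

end
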